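(* Let $(M,\varphi,\xi,\eta,g,\alpha,\beta)$ be a $3$-dimensional compact and connected trans-Sasakian manifold. Then $M$ is a cosymplectic manifold if and only if the Ricci operator $Q$ annihilates the vector field $\xi$, i.e. $Q(\xi)=0$.
   Context: All manifolds are smooth and without boundary, and $\mathfrak{X}(M)$ denotes the smooth vector fields on $M$. An almost contact metric manifold $(M,\varphi,\xi,\eta,g)$ is a Riemannian manifold $(M,g)$ of odd dimension with a $(1,1)$-tensor field $\varphi$, a unit vector field $\xi$, and the smooth $1$-form $\eta$ dual to $\xi$ (that is, $\eta(X)=g(X,\xi)$), satisfying $$\varphi^2=-I+\eta\otimes\xi,\quad \varphi(\xi)=0,\quad \eta\circ\varphi=0,\quad g(\varphi X,\varphi Y)=g(X,Y)-\eta(X)\eta(Y)$$ for all $X,Y\in\mathfrak{X}(M)$. A trans-Sasakian manifold $(M,\varphi,\xi,\eta,g,\alpha,\beta)$ (of type $(\alpha,\beta)$) is an almost contact metric manifold together with smooth functions $\alpha,\beta$ on $M$ such that $$\nabla_X(\varphi Y)-\varphi(\nabla_XY)=\alpha\big(g(X,Y)\xi-\eta(Y)X\big)+\beta\big(g(\varphi X,Y)\xi-\eta(Y)\varphi X\big)$$ for all $X,Y\in\mathfrak{X}(M)$, where $\nabla$ is the Levi-Civita connection of $g$. (These imply $\nabla_X\xi=-\alpha\varphi X+\beta(X-\eta(X)\xi)$.) The trans-Sasakian manifold is called cosymplectic if it is of type $(0,0)$, i.e. $\alpha=0$ and $\beta=0$ identically. $Ric$ denotes the Ricci tensor of $g$,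 and the Ricci operator $Q$ is the symmetric $(1,1)$-tensor field defined by $Ric(X,Y)=g(QX,Y)$. *)

theory Defs
  imports "HOL-Analysis.Analysis"
begin

section \<open>Smooth functions on open subsets of a Euclidean space\<close>

text \<open>
  Only meaningful for open \<open>S\<close>: \<open>C_on k S f\<close> says that all iterated directional
  derivatives of \<open>f\<close> up to order \<open>k\<close> along the standard basis exist and are continuous on \<open>S\<close>.
\<close>

primrec C_on :: "nat \<Rightarrow> 'e::euclidean_space set \<Rightarrow> ('e \<Rightarrow> 'f::real_normed_vector) \<Rightarrow> bool" where
  "C_on 0 S f \<longleftrightarrow> continuous_on S f"
| "C_on (Suc k) S f \<longleftrightarrow>
     (\<forall>x\<in>S. f differentiable (at x)) \<and>
     (\<forall>b\<in>Basis. C_on k S (\<lambda>x. frechet_derivative f (at x) b))"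

definition smooth_on :: "'e::euclidean_space set \<Rightarrow> ('e \<Rightarrow> 'f::real_normed_vector) \<Rightarrow> bool" where
  "smooth_on S f \<longleftrightarrow> (\<forall>k. C_on k S f)"


section \<open>Smooth manifolds\<close>

text \<open>
  A manifold without boundary modelled on the Euclidean space \<open>'e\<close>, so that its dimension
  is \<open>DIM('e)\<close>. The points are those of \<open>topspace (man_top M)\<close>; a chart is a pair
  \<open>(U, c)\<close> of its domain and its coordinate map. The atlas need not be maximal, and
  values of functions, fields, tensors outside \<open>topspace (man_top M)\<close> carry no meaning.
\<close>

record ('a, 'e) manifold =
  man_top :: "'a topology"
  atlas :: "('a set \<times> ('a \<Rightarrow> 'e)) set"

abbreviation points :: "('a, 'e) manifold \<Rightarrow> 'a set" where
  "points M \<equiv> topspace (man_top M)"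

definition smooth_manifold :: "('a, 'e::euclidean_space) manifold \<Rightarrow> bool" where
  "smooth_manifold M \<longleftrightarrow>
     Hausdorff_space (man_top M) \<and> second_countable (man_top M) \<and>
     (\<Union>(U, c)\<in>atlas M. U) = points M \<and>
     (\<forall>(U, c)\<in>atlas M. openin (man_top M) U \<and> open (c ` U) \<and>
        homeomorphic_map (subtopology (man_top M) U) (top_of_set (c ` U)) c) \<and>
     (\<forall>(U, c)\<in>atlas M. \<forall>(V, d)\<in>atlas M.
        smooth_on (c ` (U \<inter> V)) (\<lambda>x. d (inv_into U c x)))"

definition C_inf :: "('a, 'e::euclidean_space) manifold \<Rightarrow> ('a \<Rightarrow> real) set" where
  "C_inf M = {f. \<forall>(U, c)\<in>atlas M. smooth_on (c ` U) (\<lambda>x. f (inv_into U c x))}"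


section \<open>Tangent vectors and tensor fields\<close>

text \<open>
  A tangent vector at \<open>p\<close> is a derivation at \<open>p\<close> of the algebra of smooth functions, extended
  by \<open>0\<close> to non-smooth functions so that it is determined by its values on smooth ones.
  Consequently linear combinations of tangent vectors are formed pointwise, and equations
  between tangent vectors are written below by applying both sides to an arbitrary function \<open>h\<close>.
\<close>

type_synonym 'a tvec = "('a \<Rightarrow> real) \<Rightarrow> real"
type_synonym 'a vfield = "'a \<Rightarrow> 'a tvec"

definition tangent_space :: "('a, 'e::euclidean_space) manifold \<Rightarrow> 'a \<Rightarrow> 'a tvec set" where
  "tangent_space M p = {v.
     (\<forall>f\<in>C_inf M. \<forall>h\<in>C_inf M. v (\<lambda>q. f q + h q) = v f + v h) \<and>
     (\<forall>r. \<forall>f\<in>C_inf M. v (\<lambda>q. r * f q) = r * v f) \<and>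
     (\<forall>f\<in>C_inf M. \<forall>h\<in>C_inf M. v (\<lambda>q. f q * h q) = f p * v h + h p * v f) \<and>
     (\<forall>f. f \<notin> C_inf M \<longrightarrow> v f = 0)}"

definition vector_fields :: "('a, 'e::euclidean_space) manifold \<Rightarrow> 'a vfield set" where
  "vector_fields M = {X.
     (\<forall>p\<in>points M. X p \<in> tangent_space M p) \<and>
     (\<forall>f\<in>C_inf M. (\<lambda>p. X p f) \<in> C_inf M)}"

definition tensor_field_11 ::
    "('a, 'e::euclidean_space) manifold \<Rightarrow> ('a \<Rightarrow> 'a tvec \<Rightarrow> 'a tvec) \<Rightarrow> bool" where
  "tensor_field_11 M A \<longleftrightarrow>
     (\<forall>p\<in>points M. \<forall>u\<in>tangent_space M p. A p u \<in> tangent_space M p) \<and>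
     (\<forall>p\<in>points M. \<forall>u\<in>tangent_space M p. \<forall>v\<in>tangent_space M p. \<forall>a b.
        A p (\<lambda>h. a * u h + b * v h) = (\<lambda>h. a * A p u h + b * A p v h)) \<and>
     (\<forall>X\<in>vector_fields M. (\<lambda>p. A p (X p)) \<in> vector_fields M)"

definition riemannian_metric ::
    "('a, 'e::euclidean_space) manifold \<Rightarrow> ('a \<Rightarrow> 'a tvec \<Rightarrow> 'a tvec \<Rightarrow> real) \<Rightarrow> bool" where
  "riemannian_metric M g \<longleftrightarrow>
     (\<forall>p\<in>points M. \<forall>u\<in>tangent_space M p. \<forall>v\<in>tangent_space M p. g p u v = g p v u) \<and>
     (\<forall>p\<in>points M. \<forall>u\<in>tangent_space M p. \<forall>v\<in>tangent_space M p. \<forall>w\<in>tangent_space M p. \<forall>a b.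
        g p (\<lambda>h. a * u h + b * v h) w = a * g p u w + b * g p v w) \<and>
     (\<forall>p\<in>points M. \<forall>u\<in>tangent_space M p. u \<noteq> (\<lambda>h. 0) \<longrightarrow> g p u u > 0) \<and>
     (\<forall>X\<in>vector_fields M. \<forall>Y\<in>vector_fields M. (\<lambda>p. g p (X p) (Y p)) \<in> C_inf M)"


section \<open>Levi-Civita connection and Ricci curvature\<close>

definition lie_bracket :: "'a vfield \<Rightarrow> 'a vfield \<Rightarrow> 'a vfield" where
  "lie_bracket X Y = (\<lambda>p h. X p (\<lambda>q. Y q h) - Y p (\<lambda>q. X q h))"

definition affine_connection ::
    "('a, 'e::euclidean_space) manifold \<Rightarrow> ('a vfield \<Rightarrow> 'a vfield \<Rightarrow> 'a vfield) \<Rightarrow> bool" where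
  "affine_connection M D \<longleftrightarrow>
     (\<forall>X\<in>vector_fields M. \<forall>Y\<in>vector_fields M. D X Y \<in> vector_fields M) \<and>
     (\<forall>X\<in>vector_fields M. \<forall>Y\<in>vector_fields M. \<forall>Z\<in>vector_fields M. \<forall>p\<in>points M. \<forall>h.
        D (\<lambda>q k. X q k + Y q k) Z p h = D X Z p h + D Y Z p h \<and>
        D X (\<lambda>q k. Y q k + Z q k) p h = D X Y p h + D X Z p h) \<and>
     (\<forall>f\<in>C_inf M. \<forall>X\<in>vector_fields M. \<forall>Y\<in>vector_fields M. \<forall>p\<in>points M. \<forall>h.
        D (\<lambda>q k. f q * X q k) Y p h = f p * D X Y p h \<and>
        D X (\<lambda>q k. f q * Y q k) p h = X p f * Y p h + f p * D X Y p h)"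

definition levi_civita_connection ::
    "('a, 'e::euclidean_space) manifold \<Rightarrow> ('a \<Rightarrow> 'a tvec \<Rightarrow> 'a tvec \<Rightarrow> real) \<Rightarrow>
     ('a vfield \<Rightarrow> 'a vfield \<Rightarrow> 'a vfield) \<Rightarrow> bool" where
  "levi_civita_connection M g D \<longleftrightarrow>
     affine_connection M D \<and>
     (\<forall>X\<in>vector_fields M. \<forall>Y\<in>vector_fields M. \<forall>p\<in>points M. \<forall>h.
        D X Y p h - D Y X p h = lie_bracket X Y p h) \<and>
     (\<forall>X\<in>vector_fields M. \<forall>Y\<in>vector_fields M. \<forall>Z\<in>vector_fields M. \<forall>p\<in>points M.
        X p (\<lambda>q. g q (Y q) (Z q)) = g p (D X Y p) (Z p) + g p (Y p) (D X Z p))"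

definition curvature ::
    "('a vfield \<Rightarrow> 'a vfield \<Rightarrow> 'a vfield) \<Rightarrow> 'a vfield \<Rightarrow> 'a vfield \<Rightarrow> 'a vfield \<Rightarrow> 'a vfield" where
  "curvature D X Y Z = (\<lambda>p h.
     D X (D Y Z) p h - D Y (D X Z) p h - D (lie_bracket X Y) Z p h)"

definition orthonormal_at ::
    "('a, 'e::euclidean_space) manifold \<Rightarrow> ('a \<Rightarrow> 'a tvec \<Rightarrow> 'a tvec \<Rightarrow> real) \<Rightarrow> 'a \<Rightarrow>
     (nat \<Rightarrow> 'a vfield) \<Rightarrow> bool" where
  "orthonormal_at M g p E \<longleftrightarrow>
     (\<forall>i<DIM('e). E i \<in> vector_fields M) \<and>
     (\<forall>i<DIM('e). \<forall>j<DIM('e). g p (E i p) (E j p) = (if i = j then 1 else 0))"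

text \<open>
  \<open>Ric(Y, Z)\<close> at \<open>p\<close> is the trace of \<open>X \<mapsto> R(X, Y) Z\<close>, taken with respect to vector
  fields that are orthonormal at \<open>p\<close>; it does not depend on which ones are chosen.
\<close>

definition ricci ::
    "('a, 'e::euclidean_space) manifold \<Rightarrow> ('a \<Rightarrow> 'a tvec \<Rightarrow> 'a tvec \<Rightarrow> real) \<Rightarrow>
     ('a vfield \<Rightarrow> 'a vfield \<Rightarrow> 'a vfield) \<Rightarrow> 'a vfield \<Rightarrow> 'a vfield \<Rightarrow> 'a \<Rightarrow> real" where
  "ricci M g D Y Z p =
     (let E = (SOME E. orthonormal_at M g p E)
      in \<Sum>i<DIM('e). g p (curvature D (E i) Y Z p) (E i p))"

text \<open>Symmetry of \<open>Q\<close> is not imposed: it follows from that of the Ricci tensor.\<close>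

definition ricci_operator ::
    "('a, 'e::euclidean_space) manifold \<Rightarrow> ('a \<Rightarrow> 'a tvec \<Rightarrow> 'a tvec \<Rightarrow> real) \<Rightarrow>
     ('a vfield \<Rightarrow> 'a vfield \<Rightarrow> 'a vfield) \<Rightarrow> ('a \<Rightarrow> 'a tvec \<Rightarrow> 'a tvec) \<Rightarrow> bool" where
  "ricci_operator M g D Q \<longleftrightarrow>
     tensor_field_11 M Q \<and>
     (\<forall>X\<in>vector_fields M. \<forall>Y\<in>vector_fields M. \<forall>p\<in>points M.
        ricci M g D X Y p = g p (Q p (X p)) (Y p))"


section \<open>Almost contact metric and trans-Sasakian structures\<close>

definition almost_contact_metric ::
    "('a, 'e::euclidean_space) manifold \<Rightarrow> ('a \<Rightarrow> 'a tvec \<Rightarrow> 'a tvec) \<Rightarrow> 'a vfield \<Rightarrow>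
     ('a \<Rightarrow> 'a tvec \<Rightarrow> real) \<Rightarrow> ('a \<Rightarrow> 'a tvec \<Rightarrow> 'a tvec \<Rightarrow> real) \<Rightarrow> bool" where
  "almost_contact_metric M \<phi> \<xi> \<eta> g \<longleftrightarrow>
     smooth_manifold M \<and> odd DIM('e) \<and> riemannian_metric M g \<and>
     tensor_field_11 M \<phi> \<and>
     \<xi> \<in> vector_fields M \<and> (\<forall>p\<in>points M. g p (\<xi> p) (\<xi> p) = 1) \<and>
     (\<forall>p\<in>points M. \<forall>v\<in>tangent_space M p. \<eta> p v = g p v (\<xi> p)) \<and>
     (\<forall>X\<in>vector_fields M. \<forall>p\<in>points M. \<forall>h.
        \<phi> p (\<phi> p (X p)) h = - X p h + \<eta> p (X p) * \<xi> p h) \<and>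
     (\<forall>p\<in>points M. \<forall>h. \<phi> p (\<xi> p) h = 0) \<and>
     (\<forall>X\<in>vector_fields M. \<forall>p\<in>points M. \<eta> p (\<phi> p (X p)) = 0) \<and>
     (\<forall>X\<in>vector_fields M. \<forall>Y\<in>vector_fields M. \<forall>p\<in>points M.
        g p (\<phi> p (X p)) (\<phi> p (Y p)) = g p (X p) (Y p) - \<eta> p (X p) * \<eta> p (Y p))"

text \<open>The argument \<open>D\<close> below is the Levi-Civita connection of \<open>g\<close>.\<close>

definition trans_sasakian ::
    "('a, 'e::euclidean_space) manifold \<Rightarrow> ('a \<Rightarrow> 'a tvec \<Rightarrow> 'a tvec) \<Rightarrow> 'a vfield \<Rightarrow>
     ('a \<Rightarrow> 'a tvec \<Rightarrow> real) \<Rightarrow> ('a \<Rightarrow> 'a tvec \<Rightarrow> 'a tvec \<Rightarrow> real) \<Rightarrow>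
     ('a vfield \<Rightarrow> 'a vfield \<Rightarrow> 'a vfield) \<Rightarrow> ('a \<Rightarrow> real) \<Rightarrow> ('a \<Rightarrow> real) \<Rightarrow> bool" where
  "trans_sasakian M \<phi> \<xi> \<eta> g D \<alpha> \<beta> \<longleftrightarrow>
     almost_contact_metric M \<phi> \<xi> \<eta> g \<and> levi_civita_connection M g D \<and>
     \<alpha> \<in> C_inf M \<and> \<beta> \<in> C_inf M \<and>
     (\<forall>X\<in>vector_fields M. \<forall>Y\<in>vector_fields M. \<forall>p\<in>points M. \<forall>h.
        D X (\<lambda>q. \<phi> q (Y q)) p h - \<phi> p (D X Y p) h =
          \<alpha> p * (g p (X p) (Y p) * \<xi> p h - \<eta> p (Y p) * X p h) +
          \<beta> p * (g p (\<phi> p (X p)) (Y p) * \<xi> p h - \<eta> p (Y p) * \<phi> p (X p) h))"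

definition cosymplectic ::
    "('a, 'e::euclidean_space) manifold \<Rightarrow> ('a \<Rightarrow> 'a tvec \<Rightarrow> 'a tvec) \<Rightarrow> 'a vfield \<Rightarrow>
     ('a \<Rightarrow> 'a tvec \<Rightarrow> real) \<Rightarrow> ('a \<Rightarrow> 'a tvec \<Rightarrow> 'a tvec \<Rightarrow> real) \<Rightarrow>
     ('a vfield \<Rightarrow> 'a vfield \<Rightarrow> 'a vfield) \<Rightarrow> ('a \<Rightarrow> real) \<Rightarrow> ('a \<Rightarrow> real) \<Rightarrow> bool" where
  "cosymplectic M \<phi> \<xi> \<eta> g D \<alpha> \<beta> \<longleftrightarrow>
     trans_sasakian M \<phi> \<xi> \<eta> g D \<alpha> \<beta> \<and> (\<forall>p\<in>points M. \<alpha> p = 0 \<and> \<beta> p = 0)"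

end

theory Submission
  imports Defs
begin

text \<open>
  On a cosymplectic manifold \<open>\<nabla>\<xi> = 0\<close>, so \<open>R(X,Y)\<xi> = 0\<close>, and the pair symmetry of the curvature
  tensor turns this into \<open>Ric(\<xi>,Y) = 0\<close> for all \<open>Y\<close>, that is \<open>Q\<xi> = 0\<close>.

  For the converse, \<open>\<nabla>\<^sub>X\<xi> = -\<alpha>\<phi>X + \<beta>(X - \<eta>(X)\<xi>)\<close> gives a closed formula for \<open>R(X,Y)\<xi>\<close>
  (lemma \<open>curvature_xi\<close>). Its trace is, in dimension three (lemma \<open>ricci_xi\<close>),
  \<open>Ric(\<xi>,Y) = -(\<phi>Y)\<alpha> - Y\<beta> - \<eta>(Y) \<xi>\<beta> + 2(\<alpha>\<^sup>2 - \<beta>\<^sup>2) \<eta>(Y)\<close>, and the pair symmetry forces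
  \<open>\<xi>\<alpha> = -2\<alpha>\<beta>\<close> (lemma \<open>derivative_alpha_along_xi\<close>). If \<open>Q\<xi> = 0\<close>, then \<open>\<xi>\<beta> = \<alpha>\<^sup>2 - \<beta>\<^sup>2\<close> and
  \<open>Y\<beta> = -(\<phi>Y)\<alpha>\<close> for every \<open>Y\<close> orthogonal to \<open>\<xi>\<close>. In terms of \<open>z = \<beta> + i\<alpha>\<close> this says that
  \<open>\<xi>z = -z\<^sup>2\<close> and that \<open>z\<close> satisfies Cauchy-Riemann equations along the planes orthogonal to \<open>\<xi>\<close>.

  Such a \<open>z\<close> obeys a maximum principle (lemma \<open>structure_functions_vanish_at_max\<close>). Let \<open>p\<close> be a
  point where \<open>f = |z|\<^sup>2 = \<alpha>\<^sup>2 + \<beta>\<^sup>2\<close> is maximal, and suppose \<open>f(p) > 0\<close>. Since \<open>\<xi>f = -2\<beta>f\<close>, we have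
  \<open>\<beta>(p) = 0\<close>, and the first derivatives of \<open>\<alpha>\<close> and the derivatives of \<open>\<beta>\<close> orthogonal to \<open>\<xi>\<close> vanish
  at \<open>p\<close>. For \<open>X\<close> orthogonal to \<open>\<xi>\<close> and of length one at \<open>p\<close>, the Cauchy-Riemann equations collapse
  the second derivatives to a bracket:
  \<open>XXf + (\<phi>X)(\<phi>X)f = 2\<alpha> [X,\<phi>X]\<beta> = 2\<alpha> \<cdot> \<alpha>\<^sup>2 g([X,\<phi>X],\<xi>) = 4\<alpha>\<^sup>4 > 0\<close> at \<open>p\<close>,
  although both summands on the left are nonpositive at a maximum. On a compact manifold the maximum
  is attained, so \<open>\<alpha> = \<beta> = 0\<close> everywhere.

  The remaining work is the differential geometry behind these computations: smooth bump functions
  and Hadamard's lemma, by which the derivations at a point form a vector space of the right dimension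
  and every one of them extends to a global vector field; the second derivative test at a maximum
  (lemma \<open>hessian_nonpos_at_max\<close>); the symmetries of the curvature of a Levi-Civita connection; and
  the existence of vector fields orthonormal at a given point, which gives the trace defining the
  Ricci tensor its meaning.
\<close>

section \<open>Calculus of iterated differentiability\<close>

lemma C_on_cong:
  assumes "open S" "\<And>x. x \<in> S \<Longrightarrow> f x = g x" "C_on k S f"
  shows "C_on k S g"
  using assms(2,3)
proof (induction k arbitrary: f g)
  case 0
  then show ?case by (auto cong: continuous_on_cong)
next
  case (Suc k)
  have diff: "f differentiable (at x)" if "x \<in> S" for x
    using Suc.prems(2) that by simp
  have "g differentiable (at x)" if "x \<in> S" for x
    using diff[OF that] has_derivative_transform_within_open[OF _ assms(1) that] Suc.prems(1)
    unfolding differentiable_def by metis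
  moreover have "frechet_derivative f (at x) = frechet_derivative g (at x)" if "x \<in> S" for x
    using frechet_derivative_transform_within_open[OF diff[OF that] assms(1) that] Suc.prems(1) by simp
  then have "C_on k S (\<lambda>x. frechet_derivative g (at x) b)" if "b \<in> Basis" for b
    using Suc.IH[of "\<lambda>x. frechet_derivative f (at x) b" "\<lambda>x. frechet_derivative g (at x) b"]
      Suc.prems(2) that by simp
  ultimately show ?case by simp
qed

lemma C_on_subset:
  "C_on k S f \<Longrightarrow> T \<subseteq> S \<Longrightarrow> C_on k T f"
  by (induction k arbitrary: f) (auto intro: continuous_on_subset)

text \<open>
  Extensions by \<open>0\<close> are glued from pieces on different open sets; their smoothness is checked near
  each point separately.
\<close>

lemma C_on_local:
  assumes "\<And>x. x \<in> S \<Longrightarrow> \<exists>T. open T \<and> x \<in> T \<and> C_on k T f"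
  shows "C_on k S f"
  using assms
proof (induction k arbitrary: f)
  case 0
  have "isCont f x" if "x \<in> S" for x
    using 0[OF that] by (auto simp: continuous_on_eq_continuous_at)
  then show ?case by (simp add: continuous_at_imp_continuous_on)
next
  case (Suc k)
  have "f differentiable (at x)" if "x \<in> S" for x
    using Suc.prems[OF that] by auto
  moreover have "C_on k S (\<lambda>x. frechet_derivative f (at x) b)" if "b \<in> Basis" for b
  proof (rule Suc.IH)
    fix x assume "x \<in> S"
    from Suc.prems[OF this] obtain T where "open T" "x \<in> T" "C_on (Suc k) T f" by blast
    then show "\<exists>T. open T \<and> x \<in> T \<and> C_on k T (\<lambda>x. frechet_derivative f (at x) b)"
      using that by (intro exI[of _ T]) simp
  qed
  ultimately show ?case by simp
qed

lemma C_on_lower: "C_on (Suc k) S f \<Longrightarrow> C_on k S f"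
proof (induction k arbitrary: f)
  case 0
  then show ?case
    by (auto intro!: continuous_at_imp_continuous_on differentiable_imp_continuous_within)
next
  case (Suc k)
  have "C_on k S (\<lambda>x. frechet_derivative f (at x) b)" if "b \<in> Basis" for b
    by (rule Suc.IH) (use Suc.prems that in \<open>simp only: C_on.simps(2)[of "Suc k"]\<close>)
  then show ?case using Suc.prems unfolding C_on.simps(2) by blast
qed

text \<open>
  Proofs of differentiability exhibit a derivative; this rule spares them the detour through
  \<open>frechet_derivative\<close>.
\<close>

lemma C_on_SucI:
  assumes "open S" "\<And>x. x \<in> S \<Longrightarrow> (f has_derivative f' x) (at x)"
    "\<And>b. b \<in> Basis \<Longrightarrow> C_on k S (\<lambda>x. f' x b)"
  shows "C_on (Suc k) S f"
proof -
  have "f' x = frechet_derivative f (at x)" if "x \<in> S" for x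
    by (rule frechet_derivative_at[OF assms(2)[OF that]])
  then have "C_on k S (\<lambda>x. frechet_derivative f (at x) b)" if "b \<in> Basis" for b
    using C_on_cong[OF assms(1) _ assms(3)[OF that]] by auto
  then show ?thesis
    using assms(2) by (auto simp: differentiable_def)
qed

lemma C_on_SucD:
  assumes "C_on (Suc k) S f" "x \<in> S"
  shows "(f has_derivative frechet_derivative f (at x)) (at x)"
  using assms frechet_derivative_works by auto

lemma C_on_const: "C_on k S (\<lambda>x. c)"
  by (induction k arbitrary: c) auto

lemma C_on_bounded_linear_compose:
  assumes "open S" "bounded_linear L" "C_on k S f"
  shows "C_on k S (\<lambda>x. L (f x))"
  using assms(3)
proof (induction k arbitrary: f)
  case 0
  then show ?case by (auto intro: bounded_linear.continuous_on[OF assms(2)])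
next
  case (Suc k)
  show ?case
    by (rule C_on_SucI[OF assms(1) bounded_linear.has_derivative[OF assms(2) C_on_SucD[OF Suc.prems]]])
      (use Suc in auto)
qed

lemma C_on_add:
  assumes "open S" "C_on k S f" "C_on k S g"
  shows "C_on k S (\<lambda>x. f x + g x)"
  using assms(2,3)
proof (induction k arbitrary: f g)
  case 0
  then show ?case by (auto intro: continuous_intros)
next
  case (Suc k)
  show ?case
    by (rule C_on_SucI[OF assms(1) has_derivative_add[OF C_on_SucD[OF Suc.prems(1)] C_on_SucD[OF Suc.prems(2)]]])
      (use Suc in auto)
qed

lemma C_on_sum:
  assumes "open S" "\<And>i. i \<in> I \<Longrightarrow> C_on k S (f i)"
  shows "C_on k S (\<lambda>x. \<Sum>i\<in>I. f i x)"
  using assms(2)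
  by (induction I rule: infinite_finite_induct) (auto intro: C_on_const C_on_add[OF assms(1)])

lemma C_on_scaleR:
  fixes f :: "'e::euclidean_space \<Rightarrow> real"
  assumes "open S" "C_on k S f" "C_on k S g"
  shows "C_on k S (\<lambda>x. f x *\<^sub>R g x)"
  using assms(2,3)
proof (induction k arbitrary: f g)
  case 0
  then show ?case by (auto intro: continuous_intros)
next
  case (Suc k)
  show ?case
    by (rule C_on_SucI[OF assms(1) has_derivative_scaleR[OF C_on_SucD[OF Suc.prems(1)] C_on_SucD[OF Suc.prems(2)]]])
      (use Suc C_on_lower[OF Suc.prems(1)] C_on_lower[OF Suc.prems(2)] in \<open>auto intro!: C_on_add[OF assms(1)]\<close>)
qed

text \<open>
  The chain rule expresses the partial derivatives of \<open>f \<circ> g\<close> as sums of products of partial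
  derivatives of \<open>g\<close> with partial derivatives of \<open>f\<close> composed with \<open>g\<close>; the induction runs over all
  \<open>f\<close> at once so that it applies to the latter.
\<close>

lemma C_on_compose:
  fixes f :: "'e::euclidean_space \<Rightarrow> 'f::real_normed_vector" and g :: "'d::euclidean_space \<Rightarrow> 'e"
  assumes "open S" "g ` S \<subseteq> T" "C_on k T f" "C_on k S g"
  shows "C_on k S (\<lambda>x. f (g x))"
  using assms(3,4)
proof (induction k arbitrary: f)
  case 0
  then show ?case
    using continuous_on_compose2[of T f S g] assms(2) by simp
next
  case (Suc k)
  let ?f' = "\<lambda>y. frechet_derivative f (at y)" and ?g' = "\<lambda>x. frechet_derivative g (at x)"
  have f': "(f has_derivative ?f' (g x)) (at (g x))" if "x \<in> S" for x
    using C_on_SucD[OF Suc.prems(1)] that assms(2) by auto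
  have expand: "?f' (g x) (?g' x b) = (\<Sum>j\<in>Basis. (?g' x b \<bullet> j) *\<^sub>R ?f' (g x) j)" if "x \<in> S" for x b
  proof -
    interpret bounded_linear "?f' (g x)"
      using f'[OF that] by (rule has_derivative_bounded_linear)
    show ?thesis
      by (subst euclidean_representation[of "?g' x b", symmetric]) (simp only: sum scaleR)
  qed
  show ?case
  proof (rule C_on_SucI[OF assms(1)])
    show "((\<lambda>x. f (g x)) has_derivative (\<lambda>b. ?f' (g x) (?g' x b))) (at x)" if "x \<in> S" for x
      using diff_chain_at[OF C_on_SucD[OF Suc.prems(2) that] f'[OF that]] by (simp add: o_def)
    fix b :: 'd assume b: "b \<in> Basis"
    have "C_on k S (\<lambda>x. \<Sum>j\<in>Basis. (?g' x b \<bullet> j) *\<^sub>R ?f' (g x) j)"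
    proof (intro C_on_sum C_on_scaleR assms(1) C_on_bounded_linear_compose[OF _ bounded_linear_inner_left])
      show "C_on k S (\<lambda>x. ?g' x b)"
        using Suc.prems(2) b by simp
      show "C_on k S (\<lambda>x. ?f' (g x) j)" if "j \<in> Basis" for j
        using Suc.IH[of "\<lambda>y. ?f' y j"] Suc.prems C_on_lower[OF Suc.prems(2)] that by simp
    qed
    then show "C_on k S (\<lambda>x. ?f' (g x) (?g' x b))"
      by (rule C_on_cong[OF assms(1), rotated]) (simp add: expand)
  qed
qed

lemma C_on_id: "C_on k S (\<lambda>x. x)"
  by (cases k) (auto simp: C_on_const)

lemma smooth_on_cong:
  "open S \<Longrightarrow> (\<And>x. x \<in> S \<Longrightarrow> f x = g x) \<Longrightarrow> smooth_on S f \<Longrightarrow> smooth_on S g"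
  unfolding smooth_on_def by (intro allI, rule C_on_cong[of S f g]) auto

lemma smooth_on_subset: "smooth_on S f \<Longrightarrow> T \<subseteq> S \<Longrightarrow> smooth_on T f"
  unfolding smooth_on_def by (auto intro: C_on_subset)

lemma smooth_on_local:
  "(\<And>x. x \<in> S \<Longrightarrow> \<exists>T. open T \<and> x \<in> T \<and> smooth_on T f) \<Longrightarrow> smooth_on S f"
  unfolding smooth_on_def by (intro allI C_on_local) meson

lemma smooth_on_has_derivative:
  "smooth_on S f \<Longrightarrow> x \<in> S \<Longrightarrow> (f has_derivative frechet_derivative f (at x)) (at x)"
  unfolding smooth_on_def by (rule C_on_SucD) auto

lemma smooth_on_derivI:
  assumes "open S" "\<And>x. x \<in> S \<Longrightarrow> (f has_derivative f' x) (at x)"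
    "\<And>b. b \<in> Basis \<Longrightarrow> smooth_on S (\<lambda>x. f' x b)"
  shows "smooth_on S f"
  unfolding smooth_on_def
proof
  fix k show "C_on k S f"
    by (rule C_on_lower, rule C_on_SucI[OF assms(1,2)]) (use assms(3) in \<open>auto simp: smooth_on_def\<close>)
qed

lemma smooth_on_const: "smooth_on S (\<lambda>x. c)"
  by (simp add: smooth_on_def C_on_const)

lemma smooth_on_id: "smooth_on S (\<lambda>x. x)"
  by (simp add: smooth_on_def C_on_id)

lemma smooth_on_add: "open S \<Longrightarrow> smooth_on S f \<Longrightarrow> smooth_on S g \<Longrightarrow> smooth_on S (\<lambda>x. f x + g x)"
  by (simp add: smooth_on_def C_on_add)

lemma smooth_on_sum:
  "open S \<Longrightarrow> (\<And>i. i \<in> I \<Longrightarrow> smooth_on S (f i)) \<Longrightarrow> smooth_on S (\<lambda>x. \<Sum>i\<in>I. f i x)"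
  by (simp add: smooth_on_def C_on_sum)

lemma smooth_on_mult:
  fixes f g :: "'e::euclidean_space \<Rightarrow> real"
  shows "open S \<Longrightarrow> smooth_on S f \<Longrightarrow> smooth_on S g \<Longrightarrow> smooth_on S (\<lambda>x. f x * g x)"
  using C_on_scaleR[of S _ f g] by (simp add: smooth_on_def)

lemma smooth_on_bounded_linear_compose:
  "open S \<Longrightarrow> bounded_linear L \<Longrightarrow> smooth_on S f \<Longrightarrow> smooth_on S (\<lambda>x. L (f x))"
  by (simp add: smooth_on_def C_on_bounded_linear_compose)

lemma smooth_on_compose:
  fixes f :: "'e::euclidean_space \<Rightarrow> 'f::real_normed_vector" and g :: "'d::euclidean_space \<Rightarrow> 'e"
  shows "open S \<Longrightarrow> g ` S \<subseteq> T \<Longrightarrow> smooth_on T f \<Longrightarrow> smooth_on S g \<Longrightarrow> smooth_on S (\<lambda>x. f (g x))"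
  by (simp add: smooth_on_def C_on_compose)

lemma smooth_on_directional_derivative:
  fixes f :: "'e::euclidean_space \<Rightarrow> 'f::real_normed_vector"
  assumes "open S" "smooth_on S f"
  shows "smooth_on S (\<lambda>x. frechet_derivative f (at x) v)"
proof -
  have "frechet_derivative f (at x) v = (\<Sum>b\<in>Basis. (v \<bullet> b) *\<^sub>R frechet_derivative f (at x) b)"
    if "x \<in> S" for x
  proof -
    interpret bounded_linear "frechet_derivative f (at x)"
      using smooth_on_has_derivative[OF assms(2) that] by (rule has_derivative_bounded_linear)
    show ?thesis
      by (subst euclidean_representation[of v, symmetric]) (simp only: sum scaleR)
  qed
  moreover have "smooth_on S (\<lambda>x. frechet_derivative f (at x) b)" if "b \<in> Basis" for b
    unfolding smooth_on_def
  proof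
    fix k
    have "C_on (Suc k) S f" using assms(2) by (simp only: smooth_on_def)
    then show "C_on k S (\<lambda>x. frechet_derivative f (at x) b)" using that by simp
  qed
  then have "smooth_on S (\<lambda>x. \<Sum>b\<in>Basis. (v \<bullet> b) *\<^sub>R frechet_derivative f (at x) b)"
    by (intro smooth_on_sum smooth_on_bounded_linear_compose[OF _ bounded_linear_scaleR_right] assms(1))
  ultimately show ?thesis
    using smooth_on_cong[OF assms(1), of "\<lambda>x. \<Sum>b\<in>Basis. (v \<bullet> b) *\<^sub>R frechet_derivative f (at x) b"] by simp
qed

section \<open>Smooth bump functions\<close>

text \<open>
  The family \<open>p(1/x) exp(-1/x)\<close>, cut off at \<open>0\<close>, is closed under differentiation when \<open>p\<close> ranges
  over all polynomials, which makes the smoothness of \<open>exp(-1/x)\<close> a plain induction.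
\<close>

definition flat_exp :: "real poly \<Rightarrow> real \<Rightarrow> real" where
  "flat_exp p x = (if x > 0 then poly p (inverse x) * exp (- inverse x) else 0)"

lemma poly_div_exp_tendsto_0: "((\<lambda>t::real. poly p t / exp t) \<longlongrightarrow> 0) at_top"
proof -
  have "((\<lambda>t. \<Sum>i\<le>degree p. coeff p i * (t ^ i / exp t)) \<longlongrightarrow> (\<Sum>i\<le>degree p. coeff p i * 0)) at_top"
    by (intro tendsto_intros tendsto_power_div_exp_0)
  then show ?thesis by (simp add: poly_altdef sum_divide_distrib)
qed

lemma flat_exp_tendsto_0: "(flat_exp p \<longlongrightarrow> 0) (at 0)"
proof -
  have "((\<lambda>x. poly p (inverse x) / exp (inverse x)) \<longlongrightarrow> 0) (at_right 0)"
    by (rule filterlim_compose[OF poly_div_exp_tendsto_0 filterlim_inverse_at_top_right])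
  moreover have "\<forall>\<^sub>F x in at_right 0. poly p (inverse x) / exp (inverse x) = flat_exp p x"
    by (rule eventually_at_rightI[of 0 1]) (auto simp: flat_exp_def exp_minus field_simps)
  ultimately have right: "(flat_exp p \<longlongrightarrow> 0) (at_right 0)"
    using Lim_transform_eventually by blast
  have "\<forall>\<^sub>F x in at_left 0. 0 = flat_exp p x"
    by (rule eventually_at_leftI[of "-1" 0]) (auto simp: flat_exp_def)
  then have left: "(flat_exp p \<longlongrightarrow> 0) (at_left 0)"
    using Lim_transform_eventually[OF tendsto_const] by blast
  show ?thesis using left right by (simp add: filterlim_split_at)
qed

lemma flat_exp_has_derivative:
  "(flat_exp p has_real_derivative flat_exp ([:0, 0, 1:] * (p - pderiv p)) x) (at x)"
proof -
  consider "x > 0" | "x < 0" | "x = 0" by linarith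
  then show ?thesis
  proof cases
    case 1
    have "((\<lambda>x. poly p (inverse x) * exp (- inverse x)) has_real_derivative
        flat_exp ([:0, 0, 1:] * (p - pderiv p)) x) (at x)"
      using 1 by (auto intro!: derivative_eq_intros DERIV_chain2[OF poly_DERIV]
        simp: flat_exp_def power2_eq_square algebra_simps)
    moreover have "\<forall>\<^sub>F y in nhds x. poly p (inverse y) * exp (- inverse y) = flat_exp p y"
      using eventually_nhds_in_open[of "{0<..}" x] 1 by (auto elim!: eventually_mono simp: flat_exp_def)
    ultimately show ?thesis
      using DERIV_cong_ev[OF refl, of "\<lambda>y. poly p (inverse y) * exp (- inverse y)" "flat_exp p" x] by simp
  next
    case 2
    have "\<forall>\<^sub>F y in nhds x. 0 = flat_exp p y"
      using eventually_nhds_in_open[of "{..<0}" x] 2 by (auto elim!: eventually_mono simp: flat_exp_def)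
    then have "(flat_exp p has_real_derivative 0) (at x)"
      using DERIV_cong_ev[OF refl _ refl, of "\<lambda>y. 0" "flat_exp p" x 0] by simp
    with 2 show ?thesis by (simp add: flat_exp_def)
  next
    case 3
    have "\<forall>\<^sub>F h in at 0. flat_exp ([:0, 1:] * p) h = (flat_exp p (0 + h) - flat_exp p 0) / h"
      by (auto simp: eventually_at_filter flat_exp_def field_simps)
    from Lim_transform_eventually[OF flat_exp_tendsto_0 this]
    have "(flat_exp p has_real_derivative 0) (at 0)"
      unfolding DERIV_def .
    with 3 show ?thesis by (simp add: flat_exp_def)
  qed
qed

lemma smooth_on_flat_exp: "smooth_on UNIV (flat_exp p)"
  unfolding smooth_on_def
proof
  fix k show "C_on k UNIV (flat_exp p)"
  proof (induction k arbitrary: p)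
    case 0
    show ?case
      by (auto intro!: continuous_at_imp_continuous_on DERIV_isCont flat_exp_has_derivative)
  next
    case (Suc k)
    show ?case
      by (rule C_on_SucI[OF _ flat_exp_has_derivative[unfolded has_field_derivative_def]]) (use Suc in auto)
  qed
qed

lemma smooth_on_inner_self:
  fixes x0 :: "'e::euclidean_space"
  shows "smooth_on UNIV (\<lambda>x. (x - x0) \<bullet> (x - x0))"
proof (rule smooth_on_derivI)
  show "((\<lambda>x. (x - x0) \<bullet> (x - x0)) has_derivative (\<lambda>h. 2 * ((x - x0) \<bullet> h))) (at x)" for x
    by (auto intro!: derivative_eq_intros simp: inner_commute)
  show "smooth_on UNIV (\<lambda>x. 2 * ((x - x0) \<bullet> b))" for b
  proof -
    have "bounded_linear (\<lambda>x. 2 * (x \<bullet> b))"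
      by (intro bounded_linear_intros bounded_linear_compose[OF bounded_linear_mult_right])
    then have "smooth_on UNIV (\<lambda>x. 2 * (x \<bullet> b) + (- 2 * (x0 \<bullet> b)))"
      by (intro smooth_on_add smooth_on_const smooth_on_bounded_linear_compose[of _ "\<lambda>x. 2 * (x \<bullet> b)"] smooth_on_id open_UNIV)
    then show ?thesis by (simp add: inner_diff_left algebra_simps)
  qed
qed auto

text \<open>
  Compose the cut-off exponential with \<open>1 - |x - x0|\<^sup>2 / r\<^sup>2\<close>, which is positive exactly inside
  the ball of radius \<open>r\<close>. Below, only the value at the centre matters; the function need not be
  constant near it.
\<close>

lemma exists_smooth_bump:
  fixes x0 :: "'e::euclidean_space"
  assumes "r > 0"
  obtains \<psi> :: "'e \<Rightarrow> real"
  where "smooth_on UNIV \<psi>" "\<psi> x0 = 1" "\<And>x. x \<notin> cball x0 r \<Longrightarrow> \<psi> x = 0"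
proof
  define s where "s x = (r\<^sup>2 - (x - x0) \<bullet> (x - x0)) / r\<^sup>2" for x
  have "smooth_on UNIV (\<lambda>x. (- (1 / r\<^sup>2)) * ((x - x0) \<bullet> (x - x0)) + 1)"
    by (intro smooth_on_add smooth_on_mult smooth_on_const smooth_on_inner_self open_UNIV)
  also have "(\<lambda>x. (- (1 / r\<^sup>2)) * ((x - x0) \<bullet> (x - x0)) + 1) = s"
    using assms by (auto simp: s_def field_simps fun_eq_iff)
  finally have s: "smooth_on UNIV s" .
  show "smooth_on UNIV (\<lambda>x. exp 1 * flat_exp 1 (s x))"
    by (intro smooth_on_mult smooth_on_const smooth_on_compose[OF _ _ smooth_on_flat_exp s]) auto
  show "exp 1 * flat_exp 1 (s x0) = 1"
    using assms by (simp add: s_def flat_exp_def exp_minus)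
  show "exp 1 * flat_exp 1 (s x) = 0" if "x \<notin> cball x0 r" for x
  proof -
    have "r\<^sup>2 < (norm (x - x0))\<^sup>2"
      using that assms by (intro power_strict_mono) (auto simp: dist_norm norm_minus_commute)
    then have "s x \<le> 0"
      using assms by (simp add: s_def dot_square_norm divide_nonpos_pos less_imp_le)
    then show ?thesis by (simp add: flat_exp_def)
  qed
qed

section \<open>Hadamard's lemma and the second derivative test\<close>

lemma ray_in_ball:
  fixes x0 :: "'e::real_normed_vector"
  assumes "x \<in> ball x0 R" "t \<in> cbox 0 1"
  shows "x0 + t *\<^sub>R (x - x0) \<in> ball x0 R"
proof -
  have "norm (t *\<^sub>R (x - x0)) \<le> 1 * norm (x - x0)"
    using assms(2) unfolding norm_scaleR by (intro mult_right_mono) auto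
  then show ?thesis using assms(1) by (simp add: dist_norm norm_minus_commute)
qed

lemma continuous_on_ray:
  fixes x0 :: "'e::real_normed_vector"
  assumes "continuous_on (ball x0 R) K"
  shows "continuous_on (ball x0 R \<times> cbox 0 (1::real)) (\<lambda>y. K (x0 + snd y *\<^sub>R (fst y - x0)))"
  by (rule continuous_on_compose2[OF assms])
    (auto intro!: continuous_intros ray_in_ball simp del: mem_ball)

lemma continuous_on_ray_param:
  fixes x0 :: "'e::real_normed_vector"
  assumes "continuous_on (ball x0 R) K" "x \<in> ball x0 R"
  shows "continuous_on (cbox 0 (1::real)) (\<lambda>t. K (x0 + t *\<^sub>R (x - x0)))"
  by (rule continuous_on_compose2[OF assms(1)])
    (use assms(2) in \<open>auto intro!: continuous_intros ray_in_ball simp del: mem_ball\<close>)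

lemma C_on_imp_continuous_on: "C_on k S f \<Longrightarrow> continuous_on S f"
  by (induction k) (simp, metis C_on_lower)

lemma smooth_on_imp_continuous_on: "smooth_on S f \<Longrightarrow> continuous_on S f"
  using C_on.simps(1)[of S f] unfolding smooth_on_def by blast

text \<open>
  Differentiating under the integral sign produces another integral of the same kind with one more
  factor \<open>t\<close>. This is why the statement carries the weight \<open>t ^ m\<close>: without it the induction would
  not close.
\<close>

lemma C_on_ray_integral:
  fixes K :: "'e::euclidean_space \<Rightarrow> real"
  assumes "C_on k (ball x0 R) K"
  shows "C_on k (ball x0 R) (\<lambda>x. integral (cbox 0 1) (\<lambda>t. t ^ m * K (x0 + t *\<^sub>R (x - x0))))"
  using assms
proof (induction k arbitrary: m K)
  case 0
  then have "continuous_on (ball x0 R) K" by simp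
  from continuous_on_ray[OF this]
  have "continuous_on (ball x0 R \<times> cbox 0 1) (\<lambda>(x, t). t ^ m * K (x0 + t *\<^sub>R (x - x0)))"
    unfolding split_beta by (intro continuous_intros)
  then show ?case
    unfolding C_on.simps(1) by (rule integral_continuous_on_param)
next
  case (Suc k)
  let ?B = "ball x0 R"
  let ?K' = "\<lambda>y. frechet_derivative K (at y)"
  define fx where "fx x t = (\<Sum>b\<in>Basis. (t ^ Suc m * ?K' (x0 + t *\<^sub>R (x - x0)) b) *\<^sub>R blinfun_inner_left b)"
    for x :: 'e and t
  have K: "continuous_on ?B K"
    by (rule C_on_imp_continuous_on[OF Suc.prems])
  have K': "C_on k ?B (\<lambda>x. ?K' x b)" if "b \<in> Basis" for b
    using Suc.prems that by simp
  have K'c: "continuous_on ?B (\<lambda>x. ?K' x b)" if "b \<in> Basis" for b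
    by (rule C_on_imp_continuous_on[OF K'[OF that]])
  have fx_apply: "blinfun_apply (fx x t) h = t ^ m * ?K' (x0 + t *\<^sub>R (x - x0)) (t *\<^sub>R h)"
    if "x \<in> ?B" "t \<in> cbox 0 1" for x t h
  proof -
    interpret bounded_linear "?K' (x0 + t *\<^sub>R (x - x0))"
      using C_on_SucD[OF Suc.prems ray_in_ball[OF that]] by (rule has_derivative_bounded_linear)
    have "?K' (x0 + t *\<^sub>R (x - x0)) h = (\<Sum>b\<in>Basis. (h \<bullet> b) *\<^sub>R ?K' (x0 + t *\<^sub>R (x - x0)) b)"
      by (subst euclidean_representation[of h, symmetric]) (simp only: sum scaleR)
    then show ?thesis
      by (simp add: fx_def blinfun.sum_left blinfun.scaleR_left scaleR sum_distrib_left mult_ac inner_commute)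
  qed
  have fx_cont: "continuous_on (?B \<times> cbox 0 1) (\<lambda>(x, t). fx x t)"
    unfolding fx_def split_beta
    by (intro continuous_intros continuous_on_ray[OF K'c])
  have fx_cont': "continuous_on (cbox 0 1) (fx x)" if "x \<in> ?B" for x
  proof -
    have "continuous_on (?B \<times> cbox 0 1) (\<lambda>y. fx (fst y) (snd y))"
      using fx_cont by (simp add: case_prod_unfold)
    from continuous_on_compose2[OF this, of "cbox 0 1" "\<lambda>t. (x, t)"] show ?thesis
      using that by (fastforce intro: continuous_intros)
  qed
  have deriv: "((\<lambda>x. integral (cbox 0 1) (\<lambda>t. t ^ m * K (x0 + t *\<^sub>R (x - x0)))) has_derivative
      integral (cbox 0 1) (fx x)) (at x within ?B)" if "x \<in> ?B" for x
  proof (rule leibniz_rule[OF _ _ fx_cont that convex_ball])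
    fix x t assume xt: "x \<in> ?B" "t \<in> cbox 0 (1::real)"
    have inner: "((\<lambda>x. x0 + t *\<^sub>R (x - x0)) has_derivative (\<lambda>h. t *\<^sub>R h)) (at x)"
      by (auto intro!: derivative_eq_intros)
    have "((\<lambda>x. t ^ m * K (x0 + t *\<^sub>R (x - x0))) has_derivative
        (\<lambda>h. t ^ m * ?K' (x0 + t *\<^sub>R (x - x0)) (t *\<^sub>R h))) (at x)"
      using diff_chain_at[OF inner C_on_SucD[OF Suc.prems ray_in_ball[OF xt]]]
      by (intro has_derivative_mult_right) (simp add: o_def)
    moreover have "blinfun_apply (fx x t) = (\<lambda>h. t ^ m * ?K' (x0 + t *\<^sub>R (x - x0)) (t *\<^sub>R h))"
      by (rule ext) (rule fx_apply[OF xt])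
    ultimately show "((\<lambda>x. t ^ m * K (x0 + t *\<^sub>R (x - x0))) has_derivative blinfun_apply (fx x t)) (at x within ?B)"
      by (simp only: has_derivative_at_withinI)
  next
    fix x assume "x \<in> ?B"
    then show "(\<lambda>t. t ^ m * K (x0 + t *\<^sub>R (x - x0))) integrable_on cbox 0 1"
      by (intro integrable_continuous continuous_intros continuous_on_ray_param[OF K])
  qed
  show ?case
  proof (rule C_on_SucI[OF open_ball])
    show "((\<lambda>x. integral (cbox 0 1) (\<lambda>t. t ^ m * K (x0 + t *\<^sub>R (x - x0)))) has_derivative
      blinfun_apply (integral (cbox 0 1) (fx x))) (at x)" if "x \<in> ?B" for x
      using deriv[OF that] at_within_open[OF that open_ball] by simp
    fix b :: 'e assume b: "b \<in> Basis"
    have "C_on k ?B (\<lambda>x. integral (cbox 0 1) (\<lambda>t. t ^ Suc m * ?K' (x0 + t *\<^sub>R (x - x0)) b))"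
      using Suc.IH[OF K'[OF b]] .
    moreover have "integral (cbox 0 1) (\<lambda>t. t ^ Suc m * ?K' (x0 + t *\<^sub>R (x - x0)) b) =
        blinfun_apply (integral (cbox 0 1) (fx x)) b" if "x \<in> ?B" for x
    proof -
      have "blinfun_apply (integral (cbox 0 1) (fx x)) b = integral (cbox 0 1) (\<lambda>t. blinfun_apply (fx x t) b)"
        using fx_cont'[OF that] by (intro blinfun_apply_integral integrable_continuous)
      also have "\<dots> = integral (cbox 0 1) (\<lambda>t. t ^ Suc m * ?K' (x0 + t *\<^sub>R (x - x0)) b)"
      proof (rule integral_cong)
        fix t :: real assume t: "t \<in> cbox 0 1"
        interpret bounded_linear "?K' (x0 + t *\<^sub>R (x - x0))"
          using C_on_SucD[OF Suc.prems ray_in_ball[OF that t]] by (rule has_derivative_bounded_linear)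
        show "blinfun_apply (fx x t) b = t ^ Suc m * ?K' (x0 + t *\<^sub>R (x - x0)) b"
          unfolding fx_apply[OF that t] by (simp add: scaleR)
      qed
      finally show ?thesis by simp
    qed
    ultimately show "C_on k ?B (\<lambda>x. blinfun_apply (integral (cbox 0 1) (fx x)) b)"
      by (rule C_on_cong[OF open_ball, rotated])
  qed
qed

text \<open>
  Integrate the derivative of \<open>F\<close> along the segment from \<open>x0\<close> to \<open>x\<close>. The point of the lemma is
  that the coefficients \<open>G b\<close> are again smooth, so that derivations can be applied to the products.
\<close>

lemma hadamard_lemma:
  fixes F :: "'e::euclidean_space \<Rightarrow> real"
  assumes F: "smooth_on (ball x0 R) F" and "R > 0"
  obtains G where "\<And>b. b \<in> Basis \<Longrightarrow> smooth_on (ball x0 R) (G b)"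
    "\<And>b. G b x0 = frechet_derivative F (at x0) b"
    "\<And>x. x \<in> ball x0 R \<Longrightarrow> F x = F x0 + (\<Sum>b\<in>Basis. ((x - x0) \<bullet> b) * G b x)"
proof
  let ?F' = "\<lambda>y. frechet_derivative F (at y)"
  define G where "G b x = integral (cbox 0 1) (\<lambda>t. t ^ 0 * ?F' (x0 + t *\<^sub>R (x - x0)) b)" for b x
  have F': "smooth_on (ball x0 R) (\<lambda>x. ?F' x b)" for b
    by (rule smooth_on_directional_derivative[OF open_ball F])
  show "smooth_on (ball x0 R) (G b)" for b
    unfolding smooth_on_def G_def
    by (intro allI C_on_ray_integral) (use F'[of b] in \<open>simp add: smooth_on_def\<close>)
  show "G b x0 = ?F' x0 b" for b
    by (simp add: G_def)
  fix x assume x: "x \<in> ball x0 R"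
  let ?ray = "\<lambda>t. x0 + t *\<^sub>R (x - x0)"
  have "((\<lambda>t. ?F' (?ray t) (x - x0)) has_integral F (?ray 1) - F (?ray 0)) {0..1}"
  proof (rule fundamental_theorem_of_calculus)
    fix t :: real assume "t \<in> {0..1}"
    then have t: "t \<in> cbox 0 1" by simp
    have ray: "(?ray has_derivative (\<lambda>h. h *\<^sub>R (x - x0))) (at t)"
      by (auto intro!: derivative_eq_intros)
    note d = smooth_on_has_derivative[OF F ray_in_ball[OF x t]]
    interpret bounded_linear "?F' (?ray t)"
      using d by (rule has_derivative_bounded_linear)
    have "((\<lambda>t. F (?ray t)) has_derivative (\<lambda>h. ?F' (?ray t) (h *\<^sub>R (x - x0)))) (at t)"
      using diff_chain_at[OF ray d] by (simp add: o_def)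
    then show "((\<lambda>t. F (?ray t)) has_vector_derivative ?F' (?ray t) (x - x0)) (at t within {0..1})"
      unfolding has_vector_derivative_def by (simp add: scaleR has_derivative_at_withinI)
  qed simp
  then have "F x - F x0 = integral (cbox 0 1) (\<lambda>t. ?F' (?ray t) (x - x0))"
    by (simp add: integral_unique)
  also have "\<dots> = integral (cbox 0 1) (\<lambda>t. \<Sum>b\<in>Basis. ((x - x0) \<bullet> b) * ?F' (?ray t) b)"
  proof (rule integral_cong)
    fix t :: real assume t: "t \<in> cbox 0 1"
    interpret bounded_linear "?F' (?ray t)"
      using smooth_on_has_derivative[OF F ray_in_ball[OF x t]] by (rule has_derivative_bounded_linear)
    show "?F' (?ray t) (x - x0) = (\<Sum>b\<in>Basis. ((x - x0) \<bullet> b) * ?F' (?ray t) b)"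
      by (subst (2) euclidean_representation[of "x - x0", symmetric]) (simp only: sum scaleR real_scaleR_def)
  qed
  also have "\<dots> = (\<Sum>b\<in>Basis. integral (cbox 0 1) (\<lambda>t. ((x - x0) \<bullet> b) * ?F' (?ray t) b))"
  proof (rule integral_sum)
    fix b :: 'e
    have "continuous_on (ball x0 R) (\<lambda>x. ?F' x b)"
      by (rule smooth_on_imp_continuous_on[OF F'])
    from continuous_on_ray_param[OF this x]
    show "(\<lambda>t. ((x - x0) \<bullet> b) * ?F' (?ray t) b) integrable_on cbox 0 1"
      by (intro integrable_continuous continuous_intros)
  qed simp
  finally show "F x = F x0 + (\<Sum>b\<in>Basis. ((x - x0) \<bullet> b) * G b x)"
    by (simp add: G_def)
qed

text \<open>
  If the second derivative in direction \<open>v\<close> were positive, the first derivative would be positive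
  shortly after the maximum, and \<open>F\<close> would increase along the line.
\<close>

lemma second_derivative_nonpos_at_max:
  fixes F :: "'e::euclidean_space \<Rightarrow> real"
  assumes "open W" "smooth_on W F" "x0 \<in> W" "\<And>x. x \<in> W \<Longrightarrow> F x \<le> F x0"
  shows "frechet_derivative F (at x0) v = 0"
    and "frechet_derivative (\<lambda>x. frechet_derivative F (at x) v) (at x0) v \<le> 0"
proof -
  let ?F' = "\<lambda>x. frechet_derivative F (at x) v"
  let ?line = "\<lambda>t::real. x0 + t *\<^sub>R v"
  have line: "(?line has_derivative (\<lambda>h. h *\<^sub>R v)) (at t)" for t
    by (auto intro!: derivative_eq_intros)
  have along: "((\<lambda>t. H (?line t)) has_real_derivative frechet_derivative H (at (?line t)) v) (at t)"
    if "smooth_on W H" "?line t \<in> W" for H :: "'e \<Rightarrow> real" and t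
  proof -
    note d = smooth_on_has_derivative[OF that]
    interpret bounded_linear "frechet_derivative H (at (?line t))"
      using d by (rule has_derivative_bounded_linear)
    show ?thesis
      using diff_chain_at[OF line d] by (simp add: o_def scaleR has_field_derivative_def mult_commute_abs)
  qed
  have "open (?line -` W)"
    by (intro open_vimage assms continuous_intros)
  moreover have "0 \<in> ?line -` W" using assms(3) by simp
  ultimately obtain e where "e > 0" "\<forall>t. dist t 0 < e \<longrightarrow> t \<in> ?line -` W"
    unfolding open_dist by blast
  then have e: "e > 0" "\<And>t. \<bar>t\<bar> < e \<Longrightarrow> ?line t \<in> W"
    by auto
  show F'0: "?F' x0 = 0"
    using DERIV_local_max[OF along[OF assms(2), of 0] e(1)] e assms(3,4) by auto
  have F': "smooth_on W ?F'"
    by (rule smooth_on_directional_derivative[OF assms(1,2)])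
  show "frechet_derivative ?F' (at x0) v \<le> 0"
  proof (rule ccontr)
    assume "\<not> ?thesis"
    then have "0 < frechet_derivative ?F' (at (?line 0)) v" by simp
    from DERIV_pos_inc_right[OF along[OF F'] this]
    obtain d where d: "d > 0" "\<And>h. 0 < h \<Longrightarrow> h < d \<Longrightarrow> 0 < ?F' (?line h)"
      using assms(3) F'0 by auto
    define h where "h = min d e / 2"
    have h: "0 < h" "h < d" "h < e" using d(1) e(1) by (auto simp: h_def)
    have "\<exists>z>0. z < h \<and> F (?line h) - F (?line 0) = (h - 0) * ?F' (?line z)"
      by (rule MVT2[OF h(1)]) (use along[OF assms(2)] e h in auto)
    then obtain z where "0 < z" "z < h" "F (?line h) - F x0 = h * ?F' (?line z)" by auto
    moreover have "F (?line h) \<le> F x0" using assms(4) e h by simp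
    moreover have "0 < h * ?F' (?line z)" using d(2)[of z] h \<open>0 < z\<close> \<open>z < h\<close> by simp
    ultimately show False by linarith
  qed
qed

section \<open>Charts and smooth functions on a manifold\<close>

lemma C_inf_D: "f \<in> C_inf M \<Longrightarrow> (U, c) \<in> atlas M \<Longrightarrow> smooth_on (c ` U) (\<lambda>x. f (inv_into U c x))"
  by (auto simp: C_inf_def)

locale smooth_mfd =
  fixes M :: "('a, 'e::euclidean_space) manifold"
  assumes smooth: "smooth_manifold M"
begin

lemma chart_properties:
  assumes "(U, c) \<in> atlas M"
  shows chart_openin: "openin (man_top M) U"
    and chart_image: "open (c ` U)"
    and chart_homeo: "homeomorphic_map (subtopology (man_top M) U) (top_of_set (c ` U)) c"
  using assms smooth unfolding smooth_manifold_def by auto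

lemma chart_subset: "(U, c) \<in> atlas M \<Longrightarrow> U \<subseteq> points M"
  by (rule openin_subset) (rule chart_openin)

lemma chart_inj: "(U, c) \<in> atlas M \<Longrightarrow> inj_on c U"
  using homeomorphic_imp_injective_map[OF chart_homeo[of U c]] chart_subset[of U c]
  by (simp add: inf_absorb2)

lemma chart_open_image:
  assumes "(U, c) \<in> atlas M" "openin (man_top M) N"
  shows "open (c ` (N \<inter> U))"
proof -
  have "openin (subtopology (man_top M) U) (N \<inter> U)"
    using assms(2) by (auto simp: openin_subtopology)
  then have "openin (top_of_set (c ` U)) (c ` (N \<inter> U))"
    using homeomorphic_imp_open_map[OF chart_homeo[OF assms(1)]] unfolding open_map_def by blast
  then show ?thesis
    using chart_image[OF assms(1)] by (rule openin_open_trans)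
qed

lemma chart_open_preimage:
  assumes "(U, c) \<in> atlas M" "open W"
  shows "openin (man_top M) {q \<in> U. c q \<in> W}"
proof -
  have "continuous_map (subtopology (man_top M) U) (top_of_set (c ` U)) c"
    using chart_homeo[OF assms(1)] by (rule homeomorphic_imp_continuous_map)
  moreover have "openin (top_of_set (c ` U)) (c ` U \<inter> W)"
    using assms(2) by (rule openin_open_Int)
  ultimately have "openin (subtopology (man_top M) U)
      {q \<in> topspace (subtopology (man_top M) U). c q \<in> c ` U \<inter> W}"
    by (rule openin_continuous_map_preimage)
  also have "{q \<in> topspace (subtopology (man_top M) U). c q \<in> c ` U \<inter> W} = {q \<in> U. c q \<in> W}"
    using chart_subset[OF assms(1)] by auto
  finally show ?thesis
    using chart_openin[OF assms(1)] openin_trans_full by blast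
qed

text \<open>
  The inverse image is compact, being the continuous image of a compact set, and compact subsets
  of a Hausdorff space are closed.
\<close>

lemma chart_closed_inverse_image:
  assumes "(U, c) \<in> atlas M" "compact C" "C \<subseteq> c ` U"
  shows "closedin (man_top M) (inv_into U c ` C)"
proof -
  let ?T = "subtopology (man_top M) U"
  obtain d where d: "homeomorphic_maps ?T (top_of_set (c ` U)) c d"
    using chart_homeo[OF assms(1)] homeomorphic_map_maps by blast
  have "d x = inv_into U c x" if x: "x \<in> C" for x
  proof -
    obtain q where q: "q \<in> U" "x = c q" using x assms(3) by blast
    then have "d (c q) = q"
      using d chart_subset[OF assms(1)] by (auto simp: homeomorphic_maps_def)
    then show ?thesis
      using q inv_into_f_f[OF chart_inj[OF assms(1)]] by simp
  qed
  then have img: "d ` C = inv_into U c ` C" by auto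
  have "compactin (top_of_set (c ` U)) C"
    using assms(2,3) by (simp add: compactin_subtopology compactin_euclidean_iff)
  moreover have "continuous_map (top_of_set (c ` U)) ?T d"
    using d by (simp add: homeomorphic_maps_def)
  ultimately have "compactin ?T (d ` C)"
    using image_compactin by blast
  then have "compactin (man_top M) (d ` C)"
    by (simp add: compactin_subtopology)
  moreover have "Hausdorff_space (man_top M)"
    using smooth by (simp add: smooth_manifold_def)
  ultimately show ?thesis
    unfolding img[symmetric] by (rule compactin_imp_closedin[rotated])
qed

lemma chart_transition:
  assumes "(U, c) \<in> atlas M" "(V, d) \<in> atlas M"
  shows "smooth_on (c ` (U \<inter> V)) (\<lambda>x. d (inv_into U c x))"
  using smooth assms unfolding smooth_manifold_def by fast

lemma exists_chart:
  assumes "p \<in> points M"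
  shows "\<exists>U c. (U, c) \<in> atlas M \<and> p \<in> U"
proof -
  have "p \<in> (\<Union>(U, c)\<in>atlas M. U)"
    using assms smooth by (simp only: smooth_manifold_def)
  then show ?thesis by blast
qed

lemma C_inf_const: "(\<lambda>q. r) \<in> C_inf M"
  by (auto simp: C_inf_def smooth_on_const)

lemma C_inf_add: "f \<in> C_inf M \<Longrightarrow> h \<in> C_inf M \<Longrightarrow> (\<lambda>q. f q + h q) \<in> C_inf M"
  unfolding C_inf_def by (auto intro!: smooth_on_add chart_image)

lemma C_inf_mult: "f \<in> C_inf M \<Longrightarrow> h \<in> C_inf M \<Longrightarrow> (\<lambda>q. f q * h q) \<in> C_inf M"
  unfolding C_inf_def by (auto intro!: smooth_on_mult chart_image)

lemma C_inf_cong: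
  assumes "f \<in> C_inf M" "\<And>q. q \<in> points M \<Longrightarrow> f q = h q"
  shows "h \<in> C_inf M"
  unfolding C_inf_def
proof clarify
  fix U c assume Uc: "(U, c) \<in> atlas M"
  have "f (inv_into U c x) = h (inv_into U c x)" if "x \<in> c ` U" for x
    using assms(2) inv_into_into[OF that] chart_subset[OF Uc] by blast
  then show "smooth_on (c ` U) (\<lambda>x. h (inv_into U c x))"
    by (rule smooth_on_cong[OF chart_image[OF Uc] _ C_inf_D[OF assms(1) Uc]])
qed

lemma C_inf_minus: "f \<in> C_inf M \<Longrightarrow> (\<lambda>q. - f q) \<in> C_inf M"
  using C_inf_mult[of "\<lambda>q. -1" f] by (simp add: C_inf_const)

lemma C_inf_diff: "f \<in> C_inf M \<Longrightarrow> h \<in> C_inf M \<Longrightarrow> (\<lambda>q. f q - h q) \<in> C_inf M"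
  using C_inf_add[of f "\<lambda>q. - h q"] by (simp add: C_inf_minus)

lemmas C_inf_intros = C_inf_const C_inf_add C_inf_mult C_inf_minus C_inf_diff

text \<open>
  The coordinate functions and coordinate vector fields below are extensions of this kind. Seen from
  another chart,
  a point either lies in the open set where the function is \<open>K\<close> composed with a smooth transition map,
  or has a neighbourhood that misses the closed support and on which the function is \<open>0\<close>.
\<close>

lemma C_inf_extend_zero:
  fixes K :: "'e \<Rightarrow> real"
  assumes Uc: "(U, c) \<in> atlas M" and W: "open W" "W \<subseteq> c ` U" and C: "compact C" "C \<subseteq> W"
    and K: "smooth_on W K" and zero: "\<And>x. x \<in> W \<Longrightarrow> x \<notin> C \<Longrightarrow> K x = 0"
  shows "(\<lambda>q. if q \<in> U \<and> c q \<in> W then K (c q) else 0) \<in> C_inf M" (is "?f \<in> _")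
  unfolding C_inf_def
proof clarify
  fix V d assume Vd: "(V, d) \<in> atlas M"
  have inv[simp]: "inv_into V d (d q) = q" if "q \<in> V" for q
    using inv_into_f_f[OF chart_inj[OF Vd] that] .
  show "smooth_on (d ` V) (\<lambda>y. ?f (inv_into V d y))"
  proof (rule smooth_on_local)
    fix y assume "y \<in> d ` V"
    then obtain q where q: "q \<in> V" "y = d q" by blast
    show "\<exists>T. open T \<and> y \<in> T \<and> smooth_on T (\<lambda>y. ?f (inv_into V d y))"
    proof (cases "q \<in> U \<and> c q \<in> W")
      case True
      let ?N = "d ` ({q \<in> U. c q \<in> W} \<inter> V)"
      have N: "open ?N"
        by (rule chart_open_image[OF Vd chart_open_preimage[OF Uc W(1)]])
      have "smooth_on ?N (\<lambda>y. c (inv_into V d y))"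
        by (rule smooth_on_subset[OF chart_transition[OF Vd Uc]]) auto
      then have "smooth_on ?N (\<lambda>y. K (c (inv_into V d y)))"
        by (intro smooth_on_compose[OF N _ K]) auto
      then have "smooth_on ?N (\<lambda>y. ?f (inv_into V d y))"
        by (rule smooth_on_cong[OF N, rotated]) auto
      then show ?thesis using N True q by blast
    next
      case False
      let ?N = "d ` ((points M - inv_into U c ` C) \<inter> V)"
      have N: "open ?N"
        using chart_closed_inverse_image[OF Uc C(1)] C(2) W(2)
        by (intro chart_open_image[OF Vd] openin_diff) auto
      have "smooth_on ?N (\<lambda>y. ?f (inv_into V d y))"
      proof (rule smooth_on_cong[OF N _ smooth_on_const[of _ 0]])
        fix y assume "y \<in> ?N"
        then obtain s where s: "s \<in> V" "y = d s" "s \<notin> inv_into U c ` C" by blast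
        have "c s \<notin> C" if "s \<in> U"
        proof
          assume "c s \<in> C"
          then have "inv_into U c (c s) \<in> inv_into U c ` C" by (rule imageI)
          then show False using s(3) inv_into_f_f[OF chart_inj[OF Uc] that] by simp
        qed
        then show "0 = ?f (inv_into V d y)"
          using s(1,2) zero[of "c s"] by auto
      qed
      moreover have "q \<notin> inv_into U c ` C"
      proof
        assume "q \<in> inv_into U c ` C"
        then obtain x where "x \<in> C" "q = inv_into U c x" by blast
        then have "q \<in> U" "c q = x" "x \<in> W"
          using C(2) W(2) inv_into_into[of x c U] f_inv_into_f[of x c U] by auto
        with False show False by simp
      qed
      then have "y \<in> ?N" using q chart_subset[OF Vd] by blast
      ultimately show ?thesis using N by blast
    qed
  qed
qed

section \<open>Tangent vectors\<close>

lemma tangent_add: "v \<in> tangent_space M p \<Longrightarrow> f \<in> C_inf M \<Longrightarrow> h \<in> C_inf M \<Longrightarrow> v (\<lambda>q. f q + h q) = v f + v h"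
  and tangent_cmult: "v \<in> tangent_space M p \<Longrightarrow> f \<in> C_inf M \<Longrightarrow> v (\<lambda>q. r * f q) = r * v f"
  and tangent_mult: "v \<in> tangent_space M p \<Longrightarrow> f \<in> C_inf M \<Longrightarrow> h \<in> C_inf M \<Longrightarrow>
    v (\<lambda>q. f q * h q) = f p * v h + h p * v f"
  and tangent_not_smooth: "v \<in> tangent_space M p \<Longrightarrow> f \<notin> C_inf M \<Longrightarrow> v f = 0"
  by (auto simp: tangent_space_def)

lemma tangent_zero: "(\<lambda>h. 0) \<in> tangent_space M p"
  by (simp add: tangent_space_def)

lemma tangent_space_add: "u \<in> tangent_space M p \<Longrightarrow> v \<in> tangent_space M p \<Longrightarrow> (\<lambda>h. u h + v h) \<in> tangent_space M p"
  by (auto simp: tangent_space_def algebra_simps)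

lemma tangent_space_cmult: "u \<in> tangent_space M p \<Longrightarrow> (\<lambda>h. r * u h) \<in> tangent_space M p"
  by (auto simp: tangent_space_def algebra_simps)

lemma tangent_const: "v \<in> tangent_space M p \<Longrightarrow> v (\<lambda>q. r) = 0"
  using tangent_mult[of v p "\<lambda>q. 1" "\<lambda>q. 1"] tangent_cmult[of v p "\<lambda>q. 1" r]
  by (simp add: C_inf_const)

lemma tangent_minus: "v \<in> tangent_space M p \<Longrightarrow> f \<in> C_inf M \<Longrightarrow> v (\<lambda>q. - f q) = - v f"
  using tangent_cmult[of v p f "-1"] by simp

lemma tangent_diff: "v \<in> tangent_space M p \<Longrightarrow> f \<in> C_inf M \<Longrightarrow> h \<in> C_inf M \<Longrightarrow> v (\<lambda>q. f q - h q) = v f - v h"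
  using tangent_add[of v p f "\<lambda>q. - h q"] by (simp add: tangent_minus C_inf_minus)

lemma tangent_sum:
  assumes "v \<in> tangent_space M p" "\<And>i. i \<in> I \<Longrightarrow> f i \<in> C_inf M"
  shows "(\<lambda>q. \<Sum>i\<in>I. f i q) \<in> C_inf M \<and> v (\<lambda>q. \<Sum>i\<in>I. f i q) = (\<Sum>i\<in>I. v (f i))"
  using assms(2)
  by (induction I rule: infinite_finite_induct)
    (auto simp: tangent_const[OF assms(1)] C_inf_const C_inf_add tangent_add[OF assms(1)])

text \<open>
  Smoothness says nothing about values outside the manifold. The function that is \<open>0\<close> on the
  manifold and \<open>1\<close> elsewhere is therefore smooth, and multiplying by it shows that a derivation cannot
  see such values either.
\<close>

lemma tangent_cong:
  assumes v: "v \<in> tangent_space M p" and p: "p \<in> points M"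
    and eq: "\<And>q. q \<in> points M \<Longrightarrow> f q = h q"
  shows "v f = v h"
proof (cases "f \<in> C_inf M")
  case True
  then have h: "h \<in> C_inf M" by (rule C_inf_cong[OF _ eq])
  define e where "e q = (if q \<in> points M then 0 else 1::real)" for q
  have e: "e \<in> C_inf M" by (rule C_inf_cong[OF C_inf_const[of 0]]) (simp add: e_def)
  have d: "(\<lambda>q. f q - h q) \<in> C_inf M" by (rule C_inf_diff[OF True h])
  have "v (\<lambda>q. f q - h q) = v (\<lambda>q. e q * (f q - h q))"
    by (rule arg_cong[of _ _ v]) (auto simp: e_def eq)
  also have "\<dots> = e p * v (\<lambda>q. f q - h q) + (f p - h p) * v e"
    by (rule tangent_mult[OF v e d])
  also have "\<dots> = 0"
    using eq[OF p] p by (simp add: e_def)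
  finally show ?thesis by (simp add: tangent_diff[OF v True h])
next
  case False
  then have "h \<notin> C_inf M" using C_inf_cong[of h f] eq by auto
  with False show ?thesis using tangent_not_smooth[OF v] by simp
qed

end

section \<open>Coordinates around a point\<close>

text \<open>
  Constructions around a point \<open>p\<close>: a chart \<open>c\<close> whose image contains the ball \<open>B\<close> of radius \<open>R\<close>
  about \<open>c p\<close>, and a bump function supported in a smaller concentric ball. It transports smooth
  functions on \<open>B\<close> to global smooth functions.
\<close>

locale bump_chart = smooth_mfd M for M :: "('a, 'e::euclidean_space) manifold" +
  fixes U :: "'a set" and c :: "'a \<Rightarrow> 'e" and p :: 'a and R r :: real and \<psi> :: "'e \<Rightarrow> real"
  assumes Uc: "(U, c) \<in> atlas M" and pU: "p \<in> U"
    and rR: "0 < r" "r < R" and ball: "ball (c p) R \<subseteq> c ` U"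
    and bump: "smooth_on UNIV \<psi>" "\<psi> (c p) = 1" "\<And>x. x \<notin> cball (c p) r \<Longrightarrow> \<psi> x = 0"
begin

abbreviation "B \<equiv> ball (c p) R"

definition in_chart :: "('a \<Rightarrow> real) \<Rightarrow> 'e \<Rightarrow> real" where
  "in_chart f = (\<lambda>x. f (inv_into U c x))"

text \<open>
  The factor \<open>\<psi>\<close> makes the extension by \<open>0\<close> smooth; it leaves the value at \<open>p\<close> unchanged.
\<close>

definition extend :: "('e \<Rightarrow> real) \<Rightarrow> 'a \<Rightarrow> real" where
  "extend K = (\<lambda>q. if q \<in> U \<and> c q \<in> B then \<psi> (c q) * K (c q) else 0)"

text \<open>
  The vector field with constant coefficients \<open>v\<close> in the chart, damped by the bump function.
\<close>

definition coord_field :: "'e \<Rightarrow> 'a vfield" where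
  "coord_field v q f = (if f \<in> C_inf M then extend (\<lambda>x. frechet_derivative (in_chart f) (at x) v) q else 0)"

lemma cpB: "c p \<in> B" using rR by simp

lemma inv_c: "q \<in> U \<Longrightarrow> inv_into U c (c q) = q"
  using inv_into_f_f[OF chart_inj[OF Uc]] .

lemma in_chart_c: "q \<in> U \<Longrightarrow> in_chart f (c q) = f q"
  by (simp add: in_chart_def inv_c)

lemma in_chart_smooth: "f \<in> C_inf M \<Longrightarrow> smooth_on B (in_chart f)"
  unfolding in_chart_def using smooth_on_subset[OF C_inf_D[OF _ Uc] ball] .

lemma extend_C_inf:
  assumes "smooth_on B K"
  shows "extend K \<in> C_inf M"
  unfolding extend_def
proof (rule C_inf_extend_zero[OF Uc open_ball ball])
  show "smooth_on B (\<lambda>x. \<psi> x * K x)"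
    using assms bump(1) by (intro smooth_on_mult open_ball) (auto intro: smooth_on_subset)
  show "compact (cball (c p) r)" "cball (c p) r \<subseteq> B"
    using rR by auto
  show "\<psi> x * K x = 0" if "x \<notin> cball (c p) r" for x
    using bump(3)[OF that] by simp
qed

lemma extend_p: "extend K p = K (c p)"
  using pU bump(2) cpB by (simp add: extend_def)

lemma in_chart_extend: "x \<in> B \<Longrightarrow> in_chart (extend K) x = \<psi> x * K x"
  using ball by (auto simp: in_chart_def extend_def f_inv_into_f inv_into_into subset_iff)

lemma in_chart_has_derivative:
  "f \<in> C_inf M \<Longrightarrow> x \<in> B \<Longrightarrow> (in_chart f has_derivative frechet_derivative (in_chart f) (at x)) (at x)"
  by (rule smooth_on_has_derivative[OF in_chart_smooth])

text \<open>
  By the product rule: the bump function is \<open>1\<close> at the centre, so the derivative of \<open>K\<close> appears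
  undamped, next to an error term proportional to \<open>K (c p)\<close>.
\<close>

lemma deriv_in_chart_extend:
  assumes K: "smooth_on B K"
  shows "frechet_derivative (in_chart (extend K)) (at (c p)) v =
    frechet_derivative K (at (c p)) v + frechet_derivative \<psi> (at (c p)) v * K (c p)"
proof -
  have "((\<lambda>x. \<psi> x * K x) has_derivative (\<lambda>v. \<psi> (c p) * frechet_derivative K (at (c p)) v
      + frechet_derivative \<psi> (at (c p)) v * K (c p))) (at (c p))"
    by (intro has_derivative_mult smooth_on_has_derivative[OF bump(1)] smooth_on_has_derivative[OF K cpB]) simp
  then have "(in_chart (extend K) has_derivative (\<lambda>v. \<psi> (c p) * frechet_derivative K (at (c p)) v
      + frechet_derivative \<psi> (at (c p)) v * K (c p))) (at (c p))"
    by (rule has_derivative_transform_within_open[OF _ open_ball cpB]) (simp add: in_chart_extend)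
  from frechet_derivative_at[OF this, symmetric] show ?thesis
    by (simp add: bump(2))
qed

lemma coord_field_C_inf: "f \<in> C_inf M \<Longrightarrow> (\<lambda>q. coord_field v q f) \<in> C_inf M"
  by (simp add: coord_field_def extend_C_inf smooth_on_directional_derivative[OF open_ball in_chart_smooth])

lemma coord_field_tangent:
  assumes "q \<in> points M"
  shows "coord_field v q \<in> tangent_space M q"
proof -
  let ?D = "\<lambda>f. frechet_derivative (in_chart f) (at (c q))"
  have "?D (\<lambda>s. f s + h s) v = ?D f v + ?D h v"
    "?D (\<lambda>s. f s * h s) v = f q * ?D h v + h q * ?D f v"
    if "f \<in> C_inf M" "h \<in> C_inf M" "q \<in> U" "c q \<in> B" for f h
  proof -
    note d = in_chart_has_derivative[OF that(1,4)] in_chart_has_derivative[OF that(2,4)]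
    show "?D (\<lambda>s. f s + h s) v = ?D f v + ?D h v"
      using frechet_derivative_at[OF has_derivative_add[OF d], symmetric] by (simp add: in_chart_def)
    show "?D (\<lambda>s. f s * h s) v = f q * ?D h v + h q * ?D f v"
      using frechet_derivative_at[OF has_derivative_mult[OF d], symmetric] in_chart_c[OF that(3)]
      by (simp add: in_chart_def inv_c[OF that(3)])
  qed
  moreover have "?D (\<lambda>s. a) v = 0" for a
    by (simp add: in_chart_def)
  ultimately show ?thesis
    unfolding tangent_space_def coord_field_def
    by (auto simp: C_inf_intros extend_def algebra_simps)
qed

lemma coord_field_vector_field: "coord_field v \<in> vector_fields M"
  by (simp add: vector_fields_def coord_field_tangent coord_field_C_inf)

definition coord :: "'e \<Rightarrow> 'a \<Rightarrow> real" where
  "coord b = extend (\<lambda>x. (x - c p) \<bullet> b)"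

lemma smooth_on_coord: "smooth_on B (\<lambda>x. (x - c p) \<bullet> b)"
proof -
  have "smooth_on B (\<lambda>x. x \<bullet> b + (- (c p \<bullet> b)))"
    by (intro smooth_on_add smooth_on_const open_ball
        smooth_on_bounded_linear_compose[OF _ bounded_linear_inner_left] smooth_on_id)
  then show ?thesis by (simp add: inner_diff_left)
qed

lemma coord_C_inf: "coord b \<in> C_inf M"
  unfolding coord_def by (rule extend_C_inf[OF smooth_on_coord])

lemma coord_p: "coord b p = 0"
  by (simp add: coord_def extend_p)

lemma coord_field_coord: "coord_field v p (coord b) = v \<bullet> b"
proof -
  have "((\<lambda>x. (x - c p) \<bullet> b) has_derivative (\<lambda>h. h \<bullet> b)) (at (c p))"
    by (auto intro!: derivative_eq_intros)
  from frechet_derivative_at[OF this, symmetric] show ?thesis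
    unfolding coord_def
    by (simp add: coord_field_def extend_C_inf[OF smooth_on_coord] extend_p deriv_in_chart_extend[OF smooth_on_coord])
qed

text \<open>
  A derivation at \<open>p\<close> is determined by its values on the coordinate functions. Let \<open>w\<close> be the global
  bump function. As \<open>w(p) = 1\<close>, a derivation does not distinguish \<open>f - f(p)\<close> from \<open>w\<^sup>2 (f - f(p))\<close>, and
  Hadamard's lemma writes the latter as a sum of products of two global smooth functions, the first of
  which, the damped coordinate, vanishes at \<open>p\<close>.
\<close>

lemma tangent_expansion:
  assumes u: "u \<in> tangent_space M p" and f: "f \<in> C_inf M"
  shows "u f = (\<Sum>b\<in>Basis. u (coord b) * frechet_derivative (in_chart f) (at (c p)) b)"
proof -
  have "0 < R" using rR by simp
  from hadamard_lemma[OF in_chart_smooth[OF f] this]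
  obtain G where G: "\<And>b. b \<in> Basis \<Longrightarrow> smooth_on B (G b)"
    "\<And>b. G b (c p) = frechet_derivative (in_chart f) (at (c p)) b"
    "\<And>x. x \<in> B \<Longrightarrow> in_chart f x = in_chart f (c p) + (\<Sum>b\<in>Basis. ((x - c p) \<bullet> b) * G b x)" by blast
  define cut where "cut = extend (\<lambda>x. 1)"
  have cut: "cut \<in> C_inf M" unfolding cut_def by (rule extend_C_inf[OF smooth_on_const])
  have cutp: "cut p = 1" by (simp add: cut_def extend_p)
  \<comment> \<open>Of the two factors, one goes to the coordinates and one to the Hadamard coefficients.\<close>
  have prod: "cut q * cut q * (f q - f p) = (\<Sum>b\<in>Basis. coord b q * extend (G b) q)" for q
  proof (cases "q \<in> U \<and> c q \<in> B")
    case True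
    then have "f q - f p = (\<Sum>b\<in>Basis. ((c q - c p) \<bullet> b) * G b (c q))"
      using G(3)[of "c q"] in_chart_c pU by simp
    with True show ?thesis
      by (simp add: cut_def coord_def extend_def sum_distrib_left mult_ac)
  next
    case False
    then have "cut q = 0" "coord b q = 0" for b
      by (simp_all only: cut_def coord_def extend_def if_False)
    then show ?thesis by simp
  qed
  have Gsm: "extend (G b) \<in> C_inf M" if "b \<in> Basis" for b
    by (rule extend_C_inf[OF G(1)[OF that]])
  have f': "(\<lambda>q. f q - f p) \<in> C_inf M" by (intro C_inf_intros f)
  have "u f = u (\<lambda>q. f q - f p)"
    using tangent_diff[OF u f C_inf_const] tangent_const[OF u] by simp
  also have "\<dots> = u (\<lambda>q. cut q * cut q * (f q - f p))"
    using tangent_mult[OF u C_inf_mult[OF cut cut] f'] by (simp add: cutp)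
  also have "\<dots> = u (\<lambda>q. \<Sum>b\<in>Basis. coord b q * extend (G b) q)"
    by (simp only: prod)
  also have "\<dots> = (\<Sum>b\<in>Basis. u (\<lambda>q. coord b q * extend (G b) q))"
    using tangent_sum[OF u, of Basis "\<lambda>b q. coord b q * extend (G b) q"] C_inf_mult[OF coord_C_inf Gsm] by blast
  also have "\<dots> = (\<Sum>b\<in>Basis. u (coord b) * frechet_derivative (in_chart f) (at (c p)) b)"
    by (rule sum.cong) (auto simp: tangent_mult[OF u coord_C_inf Gsm] coord_p extend_p G(2))
  finally show ?thesis .
qed

lemma tangent_eqI:
  assumes u: "u \<in> tangent_space M p" and w: "w \<in> tangent_space M p"
    and eq: "\<And>b. b \<in> Basis \<Longrightarrow> u (coord b) = w (coord b)"
  shows "u = w"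
proof
  fix f
  show "u f = w f"
  proof (cases "f \<in> C_inf M")
    case True
    then show ?thesis
      using tangent_expansion[OF u True] tangent_expansion[OF w True] eq by simp
  next
    case False
    then show ?thesis using tangent_not_smooth[OF u] tangent_not_smooth[OF w] by simp
  qed
qed

text \<open>
  Applying the damped field twice differentiates the damping factor too, but that term is multiplied
  by a first derivative of \<open>f\<close>, which vanishes at a maximum.
\<close>

lemma coord_field_max:
  assumes f: "f \<in> C_inf M" and max: "\<And>q. q \<in> points M \<Longrightarrow> f q \<le> f p"
  shows "coord_field v p f = 0" "coord_field v p (\<lambda>q. coord_field v q f) \<le> 0"
proof -
  have m: "in_chart f x \<le> in_chart f (c p)" if "x \<in> B" for x
  proof -
    have "inv_into U c x \<in> points M"
      using that ball chart_subset[OF Uc] inv_into_into[of x c U] by blast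
    then show ?thesis
      using max inv_c[OF pU] by (simp add: in_chart_def)
  qed
  let ?K = "\<lambda>x. frechet_derivative (in_chart f) (at x) v"
  have K: "smooth_on B ?K"
    by (rule smooth_on_directional_derivative[OF open_ball in_chart_smooth[OF f]])
  note second = second_derivative_nonpos_at_max[OF open_ball in_chart_smooth[OF f] cpB m, of v]
  show "coord_field v p f = 0"
    using second(1) f by (simp add: coord_field_def extend_p)
  have "coord_field v p (\<lambda>q. coord_field v q f) = frechet_derivative (in_chart (extend ?K)) (at (c p)) v"
    using f extend_C_inf[OF K] by (simp add: coord_field_def extend_p)
  then show "coord_field v p (\<lambda>q. coord_field v q f) \<le> 0"
    using second by (simp add: deriv_in_chart_extend[OF K])
qed

end

context smooth_mfd
begin

lemma exists_bump_chart:
  assumes "p \<in> points M"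
  shows "\<exists>U c R r \<psi>. bump_chart M U c p R r \<psi>"
proof -
  obtain U c where Uc: "(U, c) \<in> atlas M" "p \<in> U" using exists_chart[OF assms] by blast
  then obtain R where R: "R > 0" "ball (c p) R \<subseteq> c ` U"
    using chart_image[OF Uc(1)] by (meson image_eqI open_contains_ball)
  obtain \<psi> :: "'e \<Rightarrow> real" where "smooth_on UNIV \<psi>" "\<psi> (c p) = 1" "\<And>x. x \<notin> cball (c p) (R/2) \<Longrightarrow> \<psi> x = 0"
    using exists_smooth_bump[of "R/2" "c p"] R(1) by auto
  then have "bump_chart M U c p R (R/2) \<psi>"
    using Uc R by unfold_locales auto
  then show ?thesis by blast
qed

text \<open>
  The tangent space has the dimension of the manifold: the coordinates \<open>y\<close> identify it with the
  model space.
\<close>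

lemma tangent_space_coordinates:
  assumes "p \<in> points M"
  shows "\<exists>y :: 'e \<Rightarrow> 'a \<Rightarrow> real.
    (\<forall>u\<in>tangent_space M p. \<forall>w\<in>tangent_space M p. (\<forall>b\<in>Basis. u (y b) = w (y b)) \<longrightarrow> u = w) \<and>
    (\<forall>x. \<exists>u\<in>tangent_space M p. \<forall>b\<in>Basis. u (y b) = x \<bullet> b)"
proof -
  obtain U c R r \<psi> where "bump_chart M U c p R r \<psi>" using exists_bump_chart[OF assms] by blast
  then interpret bump_chart M U c p R r \<psi> .
  show ?thesis
    by (rule exI[of _ coord])
      (auto intro: tangent_eqI intro!: bexI[OF _ coord_field_tangent[OF assms]] coord_field_coord)
qed

text \<open>
  The extension has constant coefficients near \<open>p\<close> up to damping, so that its iterated derivative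
  at a maximum is an honest second derivative along a line.
\<close>

lemma tangent_vector_extends:
  assumes "p \<in> points M" "u \<in> tangent_space M p"
  obtains V where "V \<in> vector_fields M" "V p = u"
    "\<And>f. f \<in> C_inf M \<Longrightarrow> (\<And>q. q \<in> points M \<Longrightarrow> f q \<le> f p) \<Longrightarrow> V p f = 0 \<and> V p (\<lambda>q. V q f) \<le> 0"
proof -
  obtain U c R r \<psi> where "bump_chart M U c p R r \<psi>" using exists_bump_chart[OF assms(1)] by blast
  then interpret bump_chart M U c p R r \<psi> .
  let ?x = "\<Sum>b\<in>Basis. u (coord b) *\<^sub>R b"
  have "coord_field ?x p = u"
    by (rule tangent_eqI[OF coord_field_tangent[OF assms(1)] assms(2)])
      (simp add: coord_field_coord inner_sum_left inner_Basis sum.delta' if_distrib cong: if_cong)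
  then show thesis
    by (rule that[OF coord_field_vector_field]) (auto intro: coord_field_max)
qed

section \<open>Vector fields\<close>

lemma vector_field_tangent: "X \<in> vector_fields M \<Longrightarrow> p \<in> points M \<Longrightarrow> X p \<in> tangent_space M p"
  by (simp add: vector_fields_def)

lemma vector_field_C_inf: "X \<in> vector_fields M \<Longrightarrow> f \<in> C_inf M \<Longrightarrow> (\<lambda>p. X p f) \<in> C_inf M"
  by (simp add: vector_fields_def)

lemma vector_field_add:
  "X \<in> vector_fields M \<Longrightarrow> Y \<in> vector_fields M \<Longrightarrow> (\<lambda>q h. X q h + Y q h) \<in> vector_fields M"
  by (auto simp: vector_fields_def intro: tangent_space_add C_inf_add)

lemma vector_field_fmult:
  "f \<in> C_inf M \<Longrightarrow> X \<in> vector_fields M \<Longrightarrow> (\<lambda>q h. f q * X q h) \<in> vector_fields M"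
  by (auto simp: vector_fields_def intro: tangent_space_cmult C_inf_mult)

lemma vector_field_diff:
  "X \<in> vector_fields M \<Longrightarrow> Y \<in> vector_fields M \<Longrightarrow> (\<lambda>q h. X q h - Y q h) \<in> vector_fields M"
  using vector_field_add[of X "\<lambda>q h. -1 * Y q h"] vector_field_fmult[of "\<lambda>q. -1" Y] by (simp add: C_inf_const)

lemma vector_field_not_smooth:
  assumes X: "X \<in> vector_fields M" and Y: "Y \<in> vector_fields M" and p: "p \<in> points M" and h: "h \<notin> C_inf M"
  shows "X p (\<lambda>q. Y q h) = 0"
proof -
  have "X p (\<lambda>q. Y q h) = X p (\<lambda>q. 0)"
    by (rule tangent_cong[OF vector_field_tangent[OF X p] p])
      (rule tangent_not_smooth[OF vector_field_tangent[OF Y] h])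
  then show ?thesis using tangent_const[OF vector_field_tangent[OF X p]] by simp
qed

text \<open>
  In the Leibniz rule for the bracket the mixed terms \<open>(X f)(Y h)\<close> of the two iterated derivatives
  cancel.
\<close>

lemma vector_field_bracket:
  assumes X: "X \<in> vector_fields M" and Y: "Y \<in> vector_fields M"
  shows "lie_bracket X Y \<in> vector_fields M"
proof -
  have "lie_bracket X Y p \<in> tangent_space M p" if p: "p \<in> points M" for p
  proof -
    note Xp = vector_field_tangent[OF X p] and Yp = vector_field_tangent[OF Y p]
    note Xc = vector_field_C_inf[OF X] and Yc = vector_field_C_inf[OF Y]
    have add: "X p (\<lambda>q. Y q (\<lambda>s. f s + h s)) = X p (\<lambda>q. Y q f) + X p (\<lambda>q. Y q h)"
      and cmult: "X p (\<lambda>q. Y q (\<lambda>s. r * f s)) = r * X p (\<lambda>q. Y q f)"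
      and mult: "X p (\<lambda>q. Y q (\<lambda>s. f s * h s)) =
        f p * X p (\<lambda>q. Y q h) + Y p h * X p f + (h p * X p (\<lambda>q. Y q f) + Y p f * X p h)"
      if X: "X \<in> vector_fields M" and Y: "Y \<in> vector_fields M" and fh: "f \<in> C_inf M" "h \<in> C_inf M"
      for X Y f h r
    proof -
      note Xp = vector_field_tangent[OF X p] and Yq = vector_field_tangent[OF Y]
      note Yc = vector_field_C_inf[OF Y fh(1)] vector_field_C_inf[OF Y fh(2)]
      have "X p (\<lambda>q. Y q (\<lambda>s. f s + h s)) = X p (\<lambda>q. Y q f + Y q h)"
        by (rule tangent_cong[OF Xp p]) (rule tangent_add[OF Yq fh])
      then show "X p (\<lambda>q. Y q (\<lambda>s. f s + h s)) = X p (\<lambda>q. Y q f) + X p (\<lambda>q. Y q h)"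
        using tangent_add[OF Xp Yc] by simp
      have "X p (\<lambda>q. Y q (\<lambda>s. r * f s)) = X p (\<lambda>q. r * Y q f)"
        by (rule tangent_cong[OF Xp p]) (rule tangent_cmult[OF Yq fh(1)])
      then show "X p (\<lambda>q. Y q (\<lambda>s. r * f s)) = r * X p (\<lambda>q. Y q f)"
        using tangent_cmult[OF Xp Yc(1)] by simp
      have "X p (\<lambda>q. Y q (\<lambda>s. f s * h s)) = X p (\<lambda>q. f q * Y q h + h q * Y q f)"
        by (rule tangent_cong[OF Xp p]) (rule tangent_mult[OF Yq fh])
      also have "\<dots> = X p (\<lambda>q. f q * Y q h) + X p (\<lambda>q. h q * Y q f)"
        by (rule tangent_add[OF Xp]) (intro C_inf_mult fh Yc)+
      finally show "X p (\<lambda>q. Y q (\<lambda>s. f s * h s)) =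
        f p * X p (\<lambda>q. Y q h) + Y p h * X p f + (h p * X p (\<lambda>q. Y q f) + Y p f * X p h)"
        by (simp only: tangent_mult[OF Xp fh(1) Yc(2)] tangent_mult[OF Xp fh(2) Yc(1)])
    qed
    show ?thesis
      unfolding tangent_space_def lie_bracket_def mem_Collect_eq
    proof (intro conjI ballI allI impI)
      fix f h assume fh: "f \<in> C_inf M" "h \<in> C_inf M"
      show "X p (\<lambda>q. Y q (\<lambda>q. f q + h q)) - Y p (\<lambda>q. X q (\<lambda>q. f q + h q)) =
        X p (\<lambda>q. Y q f) - Y p (\<lambda>q. X q f) + (X p (\<lambda>q. Y q h) - Y p (\<lambda>q. X q h))"
        by (simp only: add[OF X Y fh] add[OF Y X fh])
      show "X p (\<lambda>q. Y q (\<lambda>q. f q * h q)) - Y p (\<lambda>q. X q (\<lambda>q. f q * h q)) =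
        f p * (X p (\<lambda>q. Y q h) - Y p (\<lambda>q. X q h)) + h p * (X p (\<lambda>q. Y q f) - Y p (\<lambda>q. X q f))"
        by (simp only: mult[OF X Y fh] mult[OF Y X fh]) (simp add: algebra_simps)
    next
      fix r f assume f: "f \<in> C_inf M"
      show "X p (\<lambda>q. Y q (\<lambda>q. r * f q)) - Y p (\<lambda>q. X q (\<lambda>q. r * f q)) =
        r * (X p (\<lambda>q. Y q f) - Y p (\<lambda>q. X q f))"
        by (simp only: cmult[OF X Y f f] cmult[OF Y X f f] right_diff_distrib)
    next
      fix f assume "f \<notin> C_inf M"
      then show "X p (\<lambda>q. Y q f) - Y p (\<lambda>q. X q f) = 0"
        using vector_field_not_smooth[OF X Y p] vector_field_not_smooth[OF Y X p] by simp
    qed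
  qed
  moreover have "(\<lambda>p. lie_bracket X Y p f) \<in> C_inf M" if "f \<in> C_inf M" for f
    unfolding lie_bracket_def
    by (rule C_inf_diff[OF vector_field_C_inf[OF X vector_field_C_inf[OF Y that]]
        vector_field_C_inf[OF Y vector_field_C_inf[OF X that]]])
  ultimately show ?thesis by (simp add: vector_fields_def)
qed

lemma jacobi_identity:
  assumes X: "X \<in> vector_fields M" and Y: "Y \<in> vector_fields M" and Z: "Z \<in> vector_fields M"
    and p: "p \<in> points M"
  shows "lie_bracket X (lie_bracket Y Z) p h + lie_bracket Y (lie_bracket Z X) p h
    + lie_bracket Z (lie_bracket X Y) p h = 0"
proof (cases "h \<in> C_inf M")
  case True
  have *: "X p (\<lambda>q. Y q (\<lambda>s. Z s h) - Z q (\<lambda>s. Y s h)) = X p (\<lambda>q. Y q (\<lambda>s. Z s h)) - X p (\<lambda>q. Z q (\<lambda>s. Y s h))"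
    if "X \<in> vector_fields M" "Y \<in> vector_fields M" "Z \<in> vector_fields M" for X Y Z
    by (rule tangent_diff[OF vector_field_tangent[OF that(1) p]
        vector_field_C_inf[OF that(2) vector_field_C_inf[OF that(3) True]]
        vector_field_C_inf[OF that(3) vector_field_C_inf[OF that(2) True]]])
  show ?thesis
    unfolding lie_bracket_def by (simp add: *[OF X Y Z] *[OF Y Z X] *[OF Z X Y])
next
  case False
  have "lie_bracket X (lie_bracket Y Z) p h = 0"
    if "X \<in> vector_fields M" "Y \<in> vector_fields M" "Z \<in> vector_fields M" for X Y Z
    by (rule tangent_not_smooth[OF vector_field_tangent[OF _ p] False]) (intro vector_field_bracket that)
  then show ?thesis using X Y Z by simp
qed

section \<open>Maxima of smooth functions\<close>

text \<open>
  The second derivative test for an arbitrary vector field \<open>X\<close>. Compare it with the extension \<open>V\<close> of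
  \<open>X p\<close> that has constant coefficients: \<open>XXf = VXf = XVf - [X,V]f = VVf\<close> at \<open>p\<close>, because all tangent
  vectors at \<open>p\<close> annihilate \<open>f\<close>.
\<close>

lemma hessian_nonpos_at_max:
  assumes p: "p \<in> points M" and X: "X \<in> vector_fields M" and f: "f \<in> C_inf M"
    and max: "\<And>q. q \<in> points M \<Longrightarrow> f q \<le> f p"
  shows "X p f = 0" "X p (\<lambda>q. X q f) \<le> 0"
proof -
  have crit: "u f = 0" if "u \<in> tangent_space M p" for u
    by (rule tangent_vector_extends[OF p that]) (use f max in auto)
  then show "X p f = 0" using vector_field_tangent[OF X p] .
  obtain V where V: "V \<in> vector_fields M" "V p = X p"
    "\<And>f. f \<in> C_inf M \<Longrightarrow> (\<And>q. q \<in> points M \<Longrightarrow> f q \<le> f p) \<Longrightarrow> V p f = 0 \<and> V p (\<lambda>q. V q f) \<le> 0"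
    using tangent_vector_extends[OF p vector_field_tangent[OF X p]] by blast
  have "lie_bracket X V p f = 0"
    by (rule crit[OF vector_field_tangent[OF vector_field_bracket[OF X V(1)] p]])
  then have "X p (\<lambda>q. X q f) = V p (\<lambda>q. V q f)"
    by (simp add: lie_bracket_def V(2))
  then show "X p (\<lambda>q. X q f) \<le> 0"
    using V(3)[OF f max] by simp
qed

lemma C_inf_continuous:
  assumes f: "f \<in> C_inf M"
  shows "continuous_map (man_top M) euclideanreal f"
  unfolding continuous_map
proof (intro conjI allI impI)
  fix W :: "real set" assume "openin euclideanreal W"
  then have W: "open W" by simp
  show "openin (man_top M) {x \<in> points M. f x \<in> W}"
  proof (subst openin_subopen, clarify)
    fix q assume q: "q \<in> points M" "f q \<in> W"
    then obtain U c where Uc: "(U, c) \<in> atlas M" "q \<in> U" using exists_chart by blast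
    have inv: "inv_into U c (c s) = s" if "s \<in> U" for s
      using inv_into_f_f[OF chart_inj[OF Uc(1)] that] .
    let ?F = "\<lambda>x. f (inv_into U c x)"
    have "continuous_on (c ` U) ?F"
      by (rule smooth_on_imp_continuous_on[OF C_inf_D[OF f Uc(1)]])
    then have "open (c ` U \<inter> ?F -` W)"
      using W chart_image[OF Uc(1)] continuous_on_open_vimage by (metis Int_commute)
    then have "openin (man_top M) {s \<in> U. c s \<in> c ` U \<inter> ?F -` W}"
      by (rule chart_open_preimage[OF Uc(1)])
    moreover have "{s \<in> U. c s \<in> c ` U \<inter> ?F -` W} \<subseteq> {x \<in> points M. f x \<in> W}"
    proof
      fix s assume "s \<in> {s \<in> U. c s \<in> c ` U \<inter> ?F -` W}"
      then have s: "s \<in> U" "?F (c s) \<in> W" by blast+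
      then show "s \<in> {x \<in> points M. f x \<in> W}"
        using chart_subset[OF Uc(1)] by (auto simp: inv)
    qed
    moreover have "q \<in> {s \<in> U. c s \<in> c ` U \<inter> ?F -` W}"
      using q Uc by (simp add: inv)
    ultimately show "\<exists>T. openin (man_top M) T \<and> q \<in> T \<and> T \<subseteq> {x \<in> points M. f x \<in> W}"
      by blast
  qed
qed auto

lemma C_inf_attains_max:
  assumes "compact_space (man_top M)" "points M \<noteq> {}" "f \<in> C_inf M"
  obtains p where "p \<in> points M" "\<And>q. q \<in> points M \<Longrightarrow> f q \<le> f p"
proof -
  have "compactin (man_top M) (points M)"
    using assms(1) by (simp add: compact_space_def)
  then have "compactin euclideanreal (f ` points M)"
    by (rule image_compactin[OF _ C_inf_continuous[OF assms(3)]])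
  then have "compact (f ` points M)" by (simp add: compactin_euclidean_iff)
  then show thesis
    using compact_attains_sup[of "f ` points M"] assms(2) that by auto
qed

end

section \<open>The Levi-Civita connection and its curvature\<close>

locale levi_civita = smooth_mfd M for M :: "('a, 'e::euclidean_space) manifold" +
  fixes g :: "'a \<Rightarrow> 'a tvec \<Rightarrow> 'a tvec \<Rightarrow> real" and D :: "'a vfield \<Rightarrow> 'a vfield \<Rightarrow> 'a vfield"
  assumes metric: "riemannian_metric M g" and connection: "levi_civita_connection M g D"
begin

lemma g_sym: "p \<in> points M \<Longrightarrow> u \<in> tangent_space M p \<Longrightarrow> v \<in> tangent_space M p \<Longrightarrow> g p u v = g p v u"
  and g_lin: "p \<in> points M \<Longrightarrow> u \<in> tangent_space M p \<Longrightarrow> v \<in> tangent_space M p \<Longrightarrow> w \<in> tangent_space M p \<Longrightarrow>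
    g p (\<lambda>h. a * u h + b * v h) w = a * g p u w + b * g p v w"
  and g_pos: "p \<in> points M \<Longrightarrow> u \<in> tangent_space M p \<Longrightarrow> u \<noteq> (\<lambda>h. 0) \<Longrightarrow> g p u u > 0"
  and g_C_inf: "X \<in> vector_fields M \<Longrightarrow> Y \<in> vector_fields M \<Longrightarrow> (\<lambda>p. g p (X p) (Y p)) \<in> C_inf M"
  using metric unfolding riemannian_metric_def by auto

lemma g_zero: "p \<in> points M \<Longrightarrow> w \<in> tangent_space M p \<Longrightarrow> g p (\<lambda>h. 0) w = 0"
  using g_lin[OF _ tangent_zero tangent_zero, of p w 0 0] by simp

lemma g_add:
  "p \<in> points M \<Longrightarrow> u \<in> tangent_space M p \<Longrightarrow> v \<in> tangent_space M p \<Longrightarrow> w \<in> tangent_space M p \<Longrightarrow>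
    g p (\<lambda>h. u h + v h) w = g p u w + g p v w"
  using g_lin[of p u v w 1 1] by simp

lemma g_cmult:
  "p \<in> points M \<Longrightarrow> u \<in> tangent_space M p \<Longrightarrow> w \<in> tangent_space M p \<Longrightarrow> g p (\<lambda>h. a * u h) w = a * g p u w"
  using g_lin[of p u u w a 0] by simp

lemma g_diff:
  "p \<in> points M \<Longrightarrow> u \<in> tangent_space M p \<Longrightarrow> v \<in> tangent_space M p \<Longrightarrow> w \<in> tangent_space M p \<Longrightarrow>
    g p (\<lambda>h. u h - v h) w = g p u w - g p v w"
  using g_lin[of p u v w 1 "-1"] by simp

lemma g_sum:
  assumes "p \<in> points M" "w \<in> tangent_space M p" "\<And>i. i \<in> I \<Longrightarrow> u i \<in> tangent_space M p"
  shows "(\<lambda>h. \<Sum>i\<in>I. a i * u i h) \<in> tangent_space M p \<and>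
    g p (\<lambda>h. \<Sum>i\<in>I. a i * u i h) w = (\<Sum>i\<in>I. a i * g p (u i) w)"
  using assms(3)
proof (induction I rule: infinite_finite_induct)
  case (insert i I)
  have i: "u i \<in> tangent_space M p" using insert.prems by simp
  show ?case
    using insert tangent_space_add[OF tangent_space_cmult[OF i, of "a i"], of "\<lambda>h. \<Sum>i\<in>I. a i * u i h"]
      g_add[OF assms(1) tangent_space_cmult[OF i, of "a i"] _ assms(2), of "\<lambda>h. \<Sum>i\<in>I. a i * u i h"]
      g_cmult[OF assms(1) i assms(2)]
    by simp
qed (auto simp: tangent_zero g_zero assms)

lemma D_vector_field: "X \<in> vector_fields M \<Longrightarrow> Y \<in> vector_fields M \<Longrightarrow> D X Y \<in> vector_fields M"
  and D_add_right: "X \<in> vector_fields M \<Longrightarrow> Y \<in> vector_fields M \<Longrightarrow> Z \<in> vector_fields M \<Longrightarrow> p \<in> points M \<Longrightarrow>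
     D X (\<lambda>q k. Y q k + Z q k) p h = D X Y p h + D X Z p h"
  and D_fmult_left: "f \<in> C_inf M \<Longrightarrow> X \<in> vector_fields M \<Longrightarrow> Y \<in> vector_fields M \<Longrightarrow> p \<in> points M \<Longrightarrow>
     D (\<lambda>q k. f q * X q k) Y p h = f p * D X Y p h"
  and D_fmult_right: "f \<in> C_inf M \<Longrightarrow> X \<in> vector_fields M \<Longrightarrow> Y \<in> vector_fields M \<Longrightarrow> p \<in> points M \<Longrightarrow>
     D X (\<lambda>q k. f q * Y q k) p h = X p f * Y p h + f p * D X Y p h"
  using connection unfolding levi_civita_connection_def affine_connection_def by blast+

lemma torsion_free: "X \<in> vector_fields M \<Longrightarrow> Y \<in> vector_fields M \<Longrightarrow> p \<in> points M \<Longrightarrow>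
    D X Y p h - D Y X p h = lie_bracket X Y p h"
  and metric_compatible: "X \<in> vector_fields M \<Longrightarrow> Y \<in> vector_fields M \<Longrightarrow> Z \<in> vector_fields M \<Longrightarrow> p \<in> points M \<Longrightarrow>
    X p (\<lambda>q. g q (Y q) (Z q)) = g p (D X Y p) (Z p) + g p (Y p) (D X Z p)"
  using connection unfolding levi_civita_connection_def by blast+

lemma D_diff_right:
  assumes "X \<in> vector_fields M" "Y \<in> vector_fields M" "Z \<in> vector_fields M" "p \<in> points M"
  shows "D X (\<lambda>q k. Y q k - Z q k) p h = D X Y p h - D X Z p h"
proof -
  have "(\<lambda>q k. -1 * Z q k) \<in> vector_fields M"
    by (intro vector_field_fmult C_inf_const assms)
  from D_add_right[OF assms(1,2) this assms(4), of h] show ?thesis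
    using D_fmult_right[OF C_inf_const assms(1,3,4), of "-1" h]
      tangent_const[OF vector_field_tangent[OF assms(1,4)]] by simp
qed

text \<open>
  A field that vanishes on the manifold is a multiple of itself by a smooth function that vanishes
  there. With \<open>D_vanishing\<close> this shows that covariant derivatives on the manifold do not depend on the
  values that the differentiated field has elsewhere.
\<close>

lemma vanishing_field_fmult:
  assumes "\<And>q. q \<in> points M \<Longrightarrow> Z q = (\<lambda>h. 0)"
  obtains f where "f \<in> C_inf M" "\<And>q. q \<in> points M \<Longrightarrow> f q = 0" "(\<lambda>q k. f q * Z q k) = Z"
proof
  let ?f = "\<lambda>q. if q \<in> points M then 0 else 1::real"
  show "?f \<in> C_inf M" by (rule C_inf_cong[OF C_inf_const[of 0]]) simp
  show "(\<lambda>q k. ?f q * Z q k) = Z" by (auto simp: fun_eq_iff assms)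
qed simp

lemma D_vanishing:
  assumes "X \<in> vector_fields M" "Z \<in> vector_fields M" "p \<in> points M"
    "\<And>q. q \<in> points M \<Longrightarrow> Z q = (\<lambda>h. 0)"
  shows "D X Z p h = 0"
proof -
  obtain f where f: "f \<in> C_inf M" "\<And>q. q \<in> points M \<Longrightarrow> f q = 0" "(\<lambda>q k. f q * Z q k) = Z"
    using vanishing_field_fmult[of Z] assms(4) by blast
  show "D X Z p h = 0"
    using D_fmult_right[OF f(1) assms(1,2,3), of h] f(2)[OF assms(3)] assms(4)[OF assms(3)] by (simp add: f(3))
qed

lemma D_cong:
  assumes X: "X \<in> vector_fields M" and YZ: "Y \<in> vector_fields M" "Z \<in> vector_fields M"
    and p: "p \<in> points M" and eq: "\<And>q h. q \<in> points M \<Longrightarrow> Y q h = Z q h"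
  shows "D X Y p h = D X Z p h"
  using D_diff_right[OF X YZ p, of h] D_vanishing[OF X vector_field_diff[OF YZ] p] eq
  by simp

lemma curvature_vector_field:
  assumes "X \<in> vector_fields M" "Y \<in> vector_fields M" "Z \<in> vector_fields M"
  shows "curvature D X Y Z \<in> vector_fields M"
  unfolding curvature_def
  by (intro vector_field_diff D_vector_field vector_field_bracket assms)

lemma curvature_skew:
  assumes X: "X \<in> vector_fields M" and Y: "Y \<in> vector_fields M" and Z: "Z \<in> vector_fields M" and p: "p \<in> points M"
  shows "curvature D X Y Z p h = - curvature D Y X Z p h"
proof -
  have "lie_bracket X Y = (\<lambda>q k. -1 * lie_bracket Y X q k)"
    by (simp add: lie_bracket_def fun_eq_iff)
  then have "D (lie_bracket X Y) Z p h = - D (lie_bracket Y X) Z p h"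
    using D_fmult_left[OF C_inf_const vector_field_bracket[OF Y X] Z p, of "-1" h] by simp
  then show ?thesis by (simp add: curvature_def)
qed

text \<open>
  By torsion-freeness the cyclic sum of curvatures is the cyclic sum of iterated brackets.
\<close>

lemma first_bianchi:
  assumes X: "X \<in> vector_fields M" and Y: "Y \<in> vector_fields M" and Z: "Z \<in> vector_fields M" and p: "p \<in> points M"
  shows "curvature D X Y Z p h + curvature D Y Z X p h + curvature D Z X Y p h = 0"
proof -
  have *: "D X (D Y Z) p h - D X (D Z Y) p h - D (lie_bracket Y Z) X p h = lie_bracket X (lie_bracket Y Z) p h"
    if XYZ: "X \<in> vector_fields M" "Y \<in> vector_fields M" "Z \<in> vector_fields M" for X Y Z
  proof -
    note DYZ = D_vector_field[OF XYZ(2,3)] D_vector_field[OF XYZ(3,2)] and br = vector_field_bracket[OF XYZ(2,3)]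
    have "D X (D Y Z) p h - D X (D Z Y) p h = D X (lie_bracket Y Z) p h"
      using D_cong[OF XYZ(1) vector_field_diff[OF DYZ] br p torsion_free[OF XYZ(2,3)], of h]
        D_diff_right[OF XYZ(1) DYZ p, of h] by simp
    then show ?thesis using torsion_free[OF XYZ(1) br p, of h] by simp
  qed
  show ?thesis
    using *[OF X Y Z] *[OF Y Z X] *[OF Z X Y] jacobi_identity[OF X Y Z p, of h]
    by (simp add: curvature_def)
qed

lemma second_derivative_g:
  assumes X: "X \<in> vector_fields M" and Y: "Y \<in> vector_fields M" and Z: "Z \<in> vector_fields M"
    and W: "W \<in> vector_fields M" and p: "p \<in> points M"
  shows "X p (\<lambda>q. Y q (\<lambda>s. g s (Z s) (W s))) =
    g p (D X (D Y Z) p) (W p) + g p (D Y Z p) (D X W p) + (g p (D X Z p) (D Y W p) + g p (Z p) (D X (D Y W) p))"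
proof -
  note DYZ = D_vector_field[OF Y Z] and DYW = D_vector_field[OF Y W]
  have "X p (\<lambda>q. Y q (\<lambda>s. g s (Z s) (W s))) = X p (\<lambda>q. g q (D Y Z q) (W q) + g q (Z q) (D Y W q))"
    by (rule tangent_cong[OF vector_field_tangent[OF X p] p]) (rule metric_compatible[OF Y Z W])
  also have "\<dots> = X p (\<lambda>q. g q (D Y Z q) (W q)) + X p (\<lambda>q. g q (Z q) (D Y W q))"
    by (intro tangent_add[OF vector_field_tangent[OF X p]] g_C_inf DYZ DYW Z W)
  finally show ?thesis
    by (simp only: metric_compatible[OF X DYZ W p] metric_compatible[OF X Z DYW p])
qed

lemma g_curvature:
  assumes "X \<in> vector_fields M" "Y \<in> vector_fields M" "Z \<in> vector_fields M" "W \<in> vector_fields M" "p \<in> points M"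
  shows "g p (curvature D X Y Z p) (W p) =
    g p (D X (D Y Z) p) (W p) - g p (D Y (D X Z) p) (W p) - g p (D (lie_bracket X Y) Z p) (W p)"
proof -
  have fields: "D X (D Y Z) \<in> vector_fields M" "D Y (D X Z) \<in> vector_fields M"
    "D (lie_bracket X Y) Z \<in> vector_fields M"
    by (intro D_vector_field vector_field_bracket assms)+
  note t = fields[THEN vector_field_tangent, OF assms(5)] vector_field_tangent[OF assms(4,5)]
    vector_field_tangent[OF vector_field_diff[OF fields(1,2)] assms(5)]
  show ?thesis
    unfolding curvature_def
    using g_diff[OF assms(5) t(5,3,4)] g_diff[OF assms(5) t(1,2,4)] by simp
qed

text \<open>
  The connection is metric, so the curvature acts on \<open>g(Z,W)\<close> as the operator \<open>XY - YX - [X,Y]\<close>,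
  which is zero on functions.
\<close>

lemma g_curvature_skew:
  assumes X: "X \<in> vector_fields M" and Y: "Y \<in> vector_fields M" and Z: "Z \<in> vector_fields M"
    and W: "W \<in> vector_fields M" and p: "p \<in> points M"
  shows "g p (curvature D X Y Z p) (W p) = - g p (curvature D X Y W p) (Z p)"
proof -
  have sym: "g p (A p) (B p) = g p (B p) (A p)" if "A \<in> vector_fields M" "B \<in> vector_fields M" for A B
    using g_sym[OF p] vector_field_tangent[OF _ p] that by simp
  note fields = D_vector_field vector_field_bracket X Y Z W
  have "g p (D (lie_bracket X Y) Z p) (W p) + g p (Z p) (D (lie_bracket X Y) W p) =
      X p (\<lambda>q. Y q (\<lambda>s. g s (Z s) (W s))) - Y p (\<lambda>q. X q (\<lambda>s. g s (Z s) (W s)))"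
    using metric_compatible[OF vector_field_bracket[OF X Y] Z W p] by (simp add: lie_bracket_def)
  then show ?thesis
    unfolding second_derivative_g[OF X Y Z W p] second_derivative_g[OF Y X Z W p]
      g_curvature[OF X Y Z W p] g_curvature[OF X Y W Z p]
    using sym[of Z "D X (D Y W)"] sym[of Z "D Y (D X W)"] sym[of Z "D (lie_bracket X Y) W"]
    by (simp add: fields)
qed

text \<open>
  A linear consequence of the Bianchi identity, written down for the four cyclic shifts of the
  arguments, and of the two skew symmetries.
\<close>

lemma g_curvature_pair_symmetry:
  assumes X: "X \<in> vector_fields M" and Y: "Y \<in> vector_fields M" and Z: "Z \<in> vector_fields M"
    and W: "W \<in> vector_fields M" and p: "p \<in> points M"
  shows "g p (curvature D X Y Z p) (W p) = g p (curvature D Z W X p) (Y p)"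
proof -
  let ?r = "\<lambda>X Y Z W. g p (curvature D X Y Z p) (W p)"
  have skew: "?r X Y Z W = - ?r Y X Z W"
    if "X \<in> vector_fields M" "Y \<in> vector_fields M" "Z \<in> vector_fields M" "W \<in> vector_fields M" for X Y Z W
  proof -
    have "curvature D X Y Z p = (\<lambda>h. -1 * curvature D Y X Z p h)"
      using curvature_skew[OF that(1-3) p] by auto
    then show ?thesis
      using g_cmult[OF p vector_field_tangent[OF curvature_vector_field[OF that(2,1,3)] p] vector_field_tangent[OF that(4) p], of "-1"]
      by simp
  qed
  have bianchi: "?r X Y Z W + ?r Y Z X W + ?r Z X Y W = 0"
    if "X \<in> vector_fields M" "Y \<in> vector_fields M" "Z \<in> vector_fields M" "W \<in> vector_fields M" for X Y Z W
  proof -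
    note t = vector_field_tangent[OF curvature_vector_field[OF that(1-3)] p]
      vector_field_tangent[OF curvature_vector_field[OF that(2,3,1)] p]
      vector_field_tangent[OF curvature_vector_field[OF that(3,1,2)] p] vector_field_tangent[OF that(4) p]
    have "g p (\<lambda>h. curvature D X Y Z p h + curvature D Y Z X p h + curvature D Z X Y p h) (W p) = 0"
      using first_bianchi[OF that(1-3) p] g_zero[OF p t(4)] by simp
    then show ?thesis
      using g_add[OF p tangent_space_add[OF t(1,2)] t(3,4)] g_add[OF p t(1,2,4)] by simp
  qed
  show ?thesis
    using bianchi[OF X Y Z W] bianchi[OF Y Z W X] bianchi[OF Z W X Y] bianchi[OF W X Y Z]
      skew[OF X Y Z W] skew[OF X Y W Z] skew[OF Y Z X W] skew[OF Y Z W X] skew[OF Z W X Y] skew[OF Z W Y X]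
      skew[OF W X Y Z] skew[OF W X Z Y] skew[OF X Z Y W] skew[OF X Z W Y] skew[OF Y W X Z] skew[OF Y W Z X]
      g_curvature_skew[OF X Y Z W p] g_curvature_skew[OF Y Z X W p] g_curvature_skew[OF Z W X Y p]
      g_curvature_skew[OF W X Y Z p] g_curvature_skew[OF X Z Y W p] g_curvature_skew[OF Y W X Z p]
      g_curvature_skew[OF Z X Y W p] g_curvature_skew[OF W Y Z X p]
    by linarith
qed

section \<open>Orthonormal frames at a point\<close>

text \<open>
  Fields orthonormal at \<open>p\<close> are as many as the dimension of the tangent space, and linearly
  independent; so they span it. The linear algebra takes place in the model space: the coordinates of
  the linear combinations of the \<open>E i p\<close> define an injective, hence surjective, endomorphism of it.
\<close>

lemma orthonormal_expansion:
  assumes p: "p \<in> points M" and E: "orthonormal_at M g p E" and w: "w \<in> tangent_space M p"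
  shows "w h = (\<Sum>i<DIM('e). g p w (E i p) * E i p h)"
proof -
  let ?N = "DIM('e)"
  have Et: "E i p \<in> tangent_space M p" if "i < ?N" for i
    using E that p vector_field_tangent unfolding orthonormal_at_def by blast
  have Eg: "g p (E i p) (E j p) = (if i = j then 1 else 0)" if "i < ?N" "j < ?N" for i j
    using E that unfolding orthonormal_at_def by blast
  from tangent_space_coordinates[OF p] obtain y :: "'e \<Rightarrow> 'a \<Rightarrow> real" where
    y: "(\<forall>u\<in>tangent_space M p. \<forall>w\<in>tangent_space M p. (\<forall>b\<in>Basis. u (y b) = w (y b)) \<longrightarrow> u = w) \<and>
    (\<forall>x. \<exists>u\<in>tangent_space M p. \<forall>b\<in>Basis. u (y b) = x \<bullet> b)" ..
  have y: "u = w" if "u \<in> tangent_space M p" "w \<in> tangent_space M p"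
    "\<And>b. b \<in> Basis \<Longrightarrow> u (y b) = w (y b)" for u w
    using conjunct1[OF y] that by simp
  obtain idx where idx: "bij_betw idx (Basis::'e set) {..<?N}"
    using ex_bij_betw_finite_nat[OF finite_Basis] by (metis atLeast0LessThan)
  let ?comb = "\<lambda>x h. \<Sum>b\<in>Basis. (x \<bullet> b) * E (idx b) p h"
  have idxN: "idx b < ?N" if "b \<in> Basis" for b
    using idx that by (auto simp: bij_betw_def)
  have comb: "?comb x \<in> tangent_space M p \<and> g p (?comb x) v = (\<Sum>b\<in>Basis. (x \<bullet> b) * g p (E (idx b) p) v)"
    if "v \<in> tangent_space M p" for x v
    by (rule g_sum[OF p that, where u = "\<lambda>b. E (idx b) p"]) (rule Et[OF idxN])
  have comb_tangent: "?comb x \<in> tangent_space M p" for x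
    using comb[OF tangent_zero] by blast
  have comb_inner: "g p (?comb x) (E (idx b) p) = x \<bullet> b" if "b \<in> Basis" for x b
  proof -
    have "g p (?comb x) (E (idx b) p) = (\<Sum>b'\<in>Basis. (x \<bullet> b') * g p (E (idx b') p) (E (idx b) p))"
      using comb[OF Et[OF idxN[OF that]]] by blast
    also have "\<dots> = (\<Sum>b'\<in>Basis. if b' = b then x \<bullet> b' else 0)"
      using idx that by (intro sum.cong) (auto simp: Eg idxN bij_betw_def inj_on_def)
    finally show ?thesis using that by simp
  qed
  let ?L = "\<lambda>x::'e. \<Sum>c\<in>Basis. ?comb x (y c) *\<^sub>R c"
  have Lc: "?L x \<bullet> c = ?comb x (y c)" if "c \<in> Basis" for x c
    using that by (simp add: inner_sum_left inner_Basis if_distrib cong: if_cong)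
  have lin: "linear ?L"
  proof (rule linearI)
    show "?L (x + z) = ?L x + ?L z" for x z
      by (simp only: inner_add_left distrib_right sum.distrib scaleR_left_distrib)
    show "?L (r *\<^sub>R x) = r *\<^sub>R ?L x" for r x
      by (simp only: inner_scaleR_left mult.assoc sum_distrib_left[symmetric] scaleR_sum_right scaleR_scaleR)
  qed
  have "x = 0" if "?L x = 0" for x
  proof -
    have "?comb x = (\<lambda>h. 0)"
      by (rule y[OF comb_tangent tangent_zero]) (use Lc[of _ x] that in simp)
    then have "x \<bullet> b = 0" if "b \<in> Basis" for b
      using comb_inner[OF that, of x] g_zero[OF p Et[OF idxN[OF that]]] by simp
    then show ?thesis by (rule euclidean_eqI[where y=0, simplified])
  qed
  then have "inj ?L" using linear_injective_0[OF lin] by blast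
  then have "surj ?L" using linear_injective_imp_surjective[OF lin] by simp
  then obtain x where x: "(\<Sum>c\<in>Basis. w (y c) *\<^sub>R c) = ?L x" by (meson surj_def)
  have "w (y c) = ?comb x (y c)" if "c \<in> Basis" for c
  proof -
    have "(\<Sum>c\<in>Basis. w (y c) *\<^sub>R c) \<bullet> c = w (y c)"
      using that by (simp add: inner_sum_left inner_Basis if_distrib cong: if_cong)
    then show ?thesis using x Lc[OF that] by simp
  qed
  then have wx: "w = ?comb x" by (intro y[OF w comb_tangent])
  then have "w h = (\<Sum>b\<in>Basis. g p w (E (idx b) p) * E (idx b) p h)"
    using comb_inner by simp
  also have "\<dots> = (\<Sum>i<?N. g p w (E i p) * E i p h)"
    using sum.reindex_bij_betw[OF idx, of "\<lambda>i. g p w (E i p) * E i p h"] by simp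
  finally show ?thesis .
qed

lemma orthonormal_parseval:
  assumes p: "p \<in> points M" and E: "orthonormal_at M g p E"
    and w: "w \<in> tangent_space M p" and v: "v \<in> tangent_space M p"
  shows "(\<Sum>i<DIM('e). g p w (E i p) * g p (E i p) v) = g p w v"
proof -
  have Et: "E i p \<in> tangent_space M p" if "i \<in> {..<DIM('e)}" for i
    using E that p vector_field_tangent unfolding orthonormal_at_def by blast
  have "w = (\<lambda>h. \<Sum>i<DIM('e). g p w (E i p) * E i p h)"
    using orthonormal_expansion[OF p E w] by blast
  then have "g p w v = g p (\<lambda>h. \<Sum>i<DIM('e). g p w (E i p) * E i p h) v" by simp
  also have "\<dots> = (\<Sum>i<DIM('e). g p w (E i p) * g p (E i p) v)"
    by (rule conjunct2[OF g_sum[OF p v, where u = "\<lambda>i. E i p"]]) (rule Et)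
  finally show ?thesis by simp
qed

end

section \<open>Trans-Sasakian structures\<close>

text \<open>
  In this context \<open>\<eta>(X)\<close> is written as \<open>g(X,\<xi>)\<close>, so that only one kind of scalar product occurs.
\<close>

locale trans_sasakian_mfd = levi_civita M g D
  for M :: "('a, 'e::euclidean_space) manifold" and g D +
  fixes \<phi> :: "'a \<Rightarrow> 'a tvec \<Rightarrow> 'a tvec" and \<xi> :: "'a vfield" and \<eta> :: "'a \<Rightarrow> 'a tvec \<Rightarrow> real"
    and \<alpha> \<beta> :: "'a \<Rightarrow> real"
  assumes ts: "trans_sasakian M \<phi> \<xi> \<eta> g D \<alpha> \<beta>"
begin

abbreviation \<Phi> :: "'a vfield \<Rightarrow> 'a vfield" where
  "\<Phi> X \<equiv> (\<lambda>p. \<phi> p (X p))"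

lemma acm: "almost_contact_metric M \<phi> \<xi> \<eta> g"
  using ts by (simp add: trans_sasakian_def)

lemma alpha_smooth: "\<alpha> \<in> C_inf M" and beta_smooth: "\<beta> \<in> C_inf M"
  using ts by (simp_all add: trans_sasakian_def)

lemma xi_vector_field: "\<xi> \<in> vector_fields M"
  and g_xi_xi: "p \<in> points M \<Longrightarrow> g p (\<xi> p) (\<xi> p) = 1"
  and phi_xi: "p \<in> points M \<Longrightarrow> \<phi> p (\<xi> p) = (\<lambda>h. 0)"
  and eta_eq: "p \<in> points M \<Longrightarrow> v \<in> tangent_space M p \<Longrightarrow> \<eta> p v = g p v (\<xi> p)"
  using acm unfolding almost_contact_metric_def by (blast | simp add: fun_eq_iff)+

lemma eta_field: "X \<in> vector_fields M \<Longrightarrow> p \<in> points M \<Longrightarrow> \<eta> p (X p) = g p (X p) (\<xi> p)"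
  by (simp add: eta_eq vector_field_tangent)

lemma Phi_vector_field: "X \<in> vector_fields M \<Longrightarrow> \<Phi> X \<in> vector_fields M"
  using acm unfolding almost_contact_metric_def tensor_field_11_def by blast

lemma phi_lin: "p \<in> points M \<Longrightarrow> u \<in> tangent_space M p \<Longrightarrow> v \<in> tangent_space M p \<Longrightarrow>
    \<phi> p (\<lambda>h. a * u h + b * v h) = (\<lambda>h. a * \<phi> p u h + b * \<phi> p v h)"
  using acm unfolding almost_contact_metric_def tensor_field_11_def by blast

lemma phi_add: "p \<in> points M \<Longrightarrow> u \<in> tangent_space M p \<Longrightarrow> v \<in> tangent_space M p \<Longrightarrow>
    \<phi> p (\<lambda>h. u h + v h) = (\<lambda>h. \<phi> p u h + \<phi> p v h)"
  using phi_lin[of p u v 1 1] by simp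

lemma phi_cmult: "p \<in> points M \<Longrightarrow> u \<in> tangent_space M p \<Longrightarrow> \<phi> p (\<lambda>h. a * u h) = (\<lambda>h. a * \<phi> p u h)"
  using phi_lin[of p u u a 0] by simp

lemma phi_phi:
  assumes "X \<in> vector_fields M" "p \<in> points M"
  shows "\<phi> p (\<phi> p (X p)) h = - X p h + g p (X p) (\<xi> p) * \<xi> p h"
  using acm assms eta_field[OF assms] unfolding almost_contact_metric_def by metis

lemma g_phi_xi:
  assumes "X \<in> vector_fields M" "p \<in> points M"
  shows "g p (\<phi> p (X p)) (\<xi> p) = 0"
  using acm assms eta_field[OF Phi_vector_field[OF assms(1)] assms(2)] unfolding almost_contact_metric_def by metis

lemma g_phi_phi:
  assumes "X \<in> vector_fields M" "Y \<in> vector_fields M" "p \<in> points M"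
  shows "g p (\<phi> p (X p)) (\<phi> p (Y p)) = g p (X p) (Y p) - g p (X p) (\<xi> p) * g p (Y p) (\<xi> p)"
  using acm assms eta_field[OF assms(1,3)] eta_field[OF assms(2,3)] unfolding almost_contact_metric_def by metis

lemma g_field_sym:
  "X \<in> vector_fields M \<Longrightarrow> Y \<in> vector_fields M \<Longrightarrow> p \<in> points M \<Longrightarrow> g p (X p) (Y p) = g p (Y p) (X p)"
  by (intro g_sym vector_field_tangent)

text \<open>
  Replace \<open>Y\<close> by \<open>\<phi>Y\<close> in \<open>g(\<phi>X,\<phi>Y) = g(X,Y) - \<eta>(X)\<eta>(Y)\<close>.
\<close>

lemma g_phi_skew:
  assumes X: "X \<in> vector_fields M" and Y: "Y \<in> vector_fields M" and p: "p \<in> points M"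
  shows "g p (\<phi> p (X p)) (Y p) = - g p (X p) (\<phi> p (Y p))"
proof -
  note PX = Phi_vector_field[OF X] and PY = Phi_vector_field[OF Y]
  have "\<phi> p (\<phi> p (Y p)) = (\<lambda>h. -1 * Y p h + g p (Y p) (\<xi> p) * \<xi> p h)"
    using phi_phi[OF Y p] by auto
  then have "g p (\<phi> p (\<phi> p (Y p))) (\<phi> p (X p)) =
      - g p (Y p) (\<phi> p (X p)) + g p (Y p) (\<xi> p) * g p (\<xi> p) (\<phi> p (X p))"
    using g_lin[OF p vector_field_tangent[OF Y p] vector_field_tangent[OF xi_vector_field p] vector_field_tangent[OF PX p], of "-1"]
    by simp
  then show ?thesis
    using g_phi_phi[OF PY X p] g_field_sym[OF xi_vector_field PX p] g_phi_xi[OF X p] g_phi_xi[OF Y p]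
      g_field_sym[OF PX Y p] g_field_sym[OF PY X p] by simp
qed

lemma D_Phi:
  assumes "X \<in> vector_fields M" "Y \<in> vector_fields M" "p \<in> points M"
  shows "D X (\<Phi> Y) p h = \<phi> p (D X Y p) h
    + \<alpha> p * (g p (X p) (Y p) * \<xi> p h - g p (Y p) (\<xi> p) * X p h)
    + \<beta> p * (g p (\<phi> p (X p)) (Y p) * \<xi> p h - g p (Y p) (\<xi> p) * \<phi> p (X p) h)"
proof -
  have "D X (\<lambda>q. \<phi> q (Y q)) p h - \<phi> p (D X Y p) h =
          \<alpha> p * (g p (X p) (Y p) * \<xi> p h - \<eta> p (Y p) * X p h) +
          \<beta> p * (g p (\<phi> p (X p)) (Y p) * \<xi> p h - \<eta> p (Y p) * \<phi> p (X p) h)"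
    using ts assms unfolding trans_sasakian_def by blast
  then show ?thesis using eta_field[OF assms(2,3)] by simp
qed

lemma g_D_xi_xi:
  assumes X: "X \<in> vector_fields M" and p: "p \<in> points M"
  shows "g p (D X \<xi> p) (\<xi> p) = 0"
proof -
  have "X p (\<lambda>q. g q (\<xi> q) (\<xi> q)) = X p (\<lambda>q. 1)"
    by (rule tangent_cong[OF vector_field_tangent[OF X p] p]) (rule g_xi_xi)
  then show ?thesis
    using metric_compatible[OF X xi_vector_field xi_vector_field p] g_field_sym[OF D_vector_field[OF X xi_vector_field] xi_vector_field p]
      tangent_const[OF vector_field_tangent[OF X p]] by simp
qed

text \<open>
  The defining equation for \<open>Y = \<xi>\<close> determines \<open>\<phi>(\<nabla>\<^sub>X\<xi>)\<close>, as \<open>\<phi>\<xi> = 0\<close>; apply \<open>\<phi>\<close> once more and use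
  that \<open>\<nabla>\<^sub>X\<xi>\<close> is orthogonal to \<open>\<xi>\<close>.
\<close>

lemma D_xi:
  assumes X: "X \<in> vector_fields M" and p: "p \<in> points M"
  shows "D X \<xi> p h = - \<alpha> p * \<phi> p (X p) h + \<beta> p * (X p h - g p (X p) (\<xi> p) * \<xi> p h)"
proof -
  let ?a = "\<alpha> p" and ?b = "\<beta> p" and ?e = "g p (X p) (\<xi> p)"
  note Xp = vector_field_tangent[OF X p] and \<xi>p = vector_field_tangent[OF xi_vector_field p]
    and PXp = vector_field_tangent[OF Phi_vector_field[OF X] p]
  have "D X (\<Phi> \<xi>) p h = 0" for h
    by (rule D_vanishing[OF X Phi_vector_field[OF xi_vector_field] p]) (rule phi_xi)
  then have "\<phi> p (D X \<xi> p) h = ?a * X p h + (- ?a * ?e) * \<xi> p h + ?b * \<phi> p (X p) h" for h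
    using D_Phi[OF X xi_vector_field p, of h] g_xi_xi[OF p] g_phi_xi[OF X p] by (simp add: algebra_simps)
  then have "\<phi> p (D X \<xi> p) = (\<lambda>h. (?a * X p h + (- ?a * ?e) * \<xi> p h) + ?b * \<phi> p (X p) h)"
    by auto
  then have "\<phi> p (\<phi> p (D X \<xi> p)) =
      \<phi> p (\<lambda>h. (?a * X p h + (- ?a * ?e) * \<xi> p h) + ?b * \<phi> p (X p) h)" by simp
  also have "\<dots> = (\<lambda>h. (?a * \<phi> p (X p) h + (- ?a * ?e) * \<phi> p (\<xi> p) h) + ?b * \<phi> p (\<phi> p (X p)) h)"
    by (simp only: phi_add[OF p tangent_space_add[OF tangent_space_cmult[OF Xp] tangent_space_cmult[OF \<xi>p]]
      tangent_space_cmult[OF PXp]] phi_lin[OF p Xp \<xi>p] phi_cmult[OF p PXp])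
  finally have "\<phi> p (\<phi> p (D X \<xi> p)) h = ?a * \<phi> p (X p) h + ?b * (- X p h + ?e * \<xi> p h)"
    using phi_phi[OF X p] by (simp add: phi_xi[OF p])
  then show ?thesis
    using phi_phi[OF D_vector_field[OF X xi_vector_field] p, of h] g_D_xi_xi[OF X p] by (simp add: algebra_simps)
qed

lemma g_D_xi:
  assumes X: "X \<in> vector_fields M" and Y: "Y \<in> vector_fields M" and p: "p \<in> points M"
  shows "g p (D X \<xi> p) (Y p) = - \<alpha> p * g p (\<phi> p (X p)) (Y p)
    + \<beta> p * (g p (X p) (Y p) - g p (X p) (\<xi> p) * g p (Y p) (\<xi> p))"
proof -
  have "D X \<xi> p = (\<lambda>h. - \<alpha> p * \<phi> p (X p) h + (\<beta> p * X p h + (- \<beta> p * g p (X p) (\<xi> p)) * \<xi> p h))"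
    using D_xi[OF X p] by (auto simp: algebra_simps)
  moreover have "g p (\<lambda>h. a * \<phi> p (X p) h + (b * X p h + c * \<xi> p h)) (Y p) =
      a * g p (\<phi> p (X p)) (Y p) + (b * g p (X p) (Y p) + c * g p (\<xi> p) (Y p))" for a b c
    using vector_field_tangent[OF X p] vector_field_tangent[OF Y p] vector_field_tangent[OF xi_vector_field p]
      vector_field_tangent[OF Phi_vector_field[OF X] p]
    by (simp add: g_add g_cmult tangent_space_add tangent_space_cmult p)
  ultimately show ?thesis
    using g_field_sym[OF xi_vector_field Y p] by (simp only:) (simp add: algebra_simps)
qed

lemma D_D_xi:
  assumes X: "X \<in> vector_fields M" and Y: "Y \<in> vector_fields M" and p: "p \<in> points M"
  shows "D X (D Y \<xi>) p h = - X p \<alpha> * \<phi> p (Y p) h - \<alpha> p * D X (\<Phi> Y) p h + X p \<beta> * Y p h + \<beta> p * D X Y p h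
    - (X p \<beta> * g p (Y p) (\<xi> p) + \<beta> p * (g p (D X Y p) (\<xi> p) + g p (D X \<xi> p) (Y p))) * \<xi> p h
    - \<beta> p * g p (Y p) (\<xi> p) * D X \<xi> p h"
proof -
  note Xp = vector_field_tangent[OF X p]
  let ?e = "\<lambda>q. g q (Y q) (\<xi> q)"
  have e: "?e \<in> C_inf M" by (rule g_C_inf[OF Y xi_vector_field])
  have be: "(\<lambda>q. \<beta> q * ?e q) \<in> C_inf M" by (rule C_inf_mult[OF beta_smooth e])
  note coef = C_inf_minus[OF alpha_smooth] beta_smooth C_inf_minus[OF be]
  let ?A = "\<lambda>q k. - \<alpha> q * \<Phi> Y q k" and ?B = "\<lambda>q k. \<beta> q * Y q k" and ?C = "\<lambda>q k. - (\<beta> q * ?e q) * \<xi> q k"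
  have A: "?A \<in> vector_fields M" and B: "?B \<in> vector_fields M" and C: "?C \<in> vector_fields M"
    using vector_field_fmult[OF coef(1) Phi_vector_field[OF Y]] vector_field_fmult[OF coef(2) Y] vector_field_fmult[OF coef(3) xi_vector_field]
    by simp_all
  have "D X (D Y \<xi>) p h = D X (\<lambda>q k. ?A q k + (?B q k + ?C q k)) p h"
    by (rule D_cong[OF X D_vector_field[OF Y xi_vector_field] vector_field_add[OF A vector_field_add[OF B C]] p])
      (simp add: D_xi[OF Y] algebra_simps)
  also have "\<dots> = D X ?A p h + (D X ?B p h + D X ?C p h)"
    using D_add_right[OF X A vector_field_add[OF B C] p, of h] D_add_right[OF X B C p, of h] by simp
  also have "D X ?A p h = X p (\<lambda>q. - \<alpha> q) * \<phi> p (Y p) h + (- \<alpha> p) * D X (\<Phi> Y) p h"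
    by (rule D_fmult_right[OF coef(1) X Phi_vector_field[OF Y] p])
  also have "D X ?B p h = X p \<beta> * Y p h + \<beta> p * D X Y p h"
    by (rule D_fmult_right[OF coef(2) X Y p])
  also have "D X ?C p h = X p (\<lambda>q. - (\<beta> q * ?e q)) * \<xi> p h + (- (\<beta> p * ?e p)) * D X \<xi> p h"
    by (rule D_fmult_right[OF coef(3) X xi_vector_field p])
  also have "X p (\<lambda>q. - (\<beta> q * ?e q)) = - (\<beta> p * X p ?e + ?e p * X p \<beta>)"
    by (simp only: tangent_minus[OF Xp be] tangent_mult[OF Xp beta_smooth e])
  also have "X p ?e = g p (D X Y p) (\<xi> p) + g p (D X \<xi> p) (Y p)"
    using metric_compatible[OF X Y xi_vector_field p] g_field_sym[OF Y D_vector_field[OF X xi_vector_field] p] by simp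
  finally show ?thesis
    by (simp add: tangent_minus[OF Xp alpha_smooth] algebra_simps)
qed

text \<open>
  Torsion-freeness removes every derivative of \<open>X\<close> and \<open>Y\<close>; what remains involves only the first
  derivatives of \<open>\<alpha>\<close> and \<open>\<beta>\<close> and the values of the fields at \<open>p\<close>.
\<close>

lemma curvature_xi:
  assumes X: "X \<in> vector_fields M" and Y: "Y \<in> vector_fields M" and p: "p \<in> points M"
  shows "curvature D X Y \<xi> p h =
      (- X p \<alpha> - 2 * \<alpha> p * \<beta> p * g p (X p) (\<xi> p)) * \<phi> p (Y p) h
    + (Y p \<alpha> + 2 * \<alpha> p * \<beta> p * g p (Y p) (\<xi> p)) * \<phi> p (X p) h
    + (X p \<beta> - ((\<alpha> p)\<^sup>2 - (\<beta> p)\<^sup>2) * g p (X p) (\<xi> p)) * Y p h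
    + (- Y p \<beta> + ((\<alpha> p)\<^sup>2 - (\<beta> p)\<^sup>2) * g p (Y p) (\<xi> p)) * X p h
    + (Y p \<beta> * g p (X p) (\<xi> p) - X p \<beta> * g p (Y p) (\<xi> p)) * \<xi> p h"
proof -
  note br = vector_field_bracket[OF X Y] and DXY = D_vector_field[OF X Y] and DYX = D_vector_field[OF Y X]
  note brp = vector_field_tangent[OF br p] and DYXp = vector_field_tangent[OF DYX p]
  have tor: "D X Y p = (\<lambda>h. D Y X p h + lie_bracket X Y p h)"
    using torsion_free[OF X Y p] by (auto simp: algebra_simps)
  have t1: "D X Y p h = D Y X p h + lie_bracket X Y p h"
    and t2: "\<phi> p (D X Y p) h = \<phi> p (D Y X p) h + \<phi> p (lie_bracket X Y p) h"
    and t3: "g p (D X Y p) (\<xi> p) = g p (D Y X p) (\<xi> p) + g p (lie_bracket X Y p) (\<xi> p)"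
    using phi_add[OF p DYXp brp] g_add[OF p DYXp brp vector_field_tangent[OF xi_vector_field p]] by (simp_all add: tor)
  have s: "g p (Y p) (X p) = g p (X p) (Y p)" "g p (\<phi> p (Y p)) (X p) = - g p (\<phi> p (X p)) (Y p)"
    using g_field_sym[OF X Y p] g_phi_skew[OF Y X p] g_field_sym[OF Y Phi_vector_field[OF X] p] by simp_all
  show ?thesis
    unfolding curvature_def D_D_xi[OF X Y p] D_D_xi[OF Y X p] D_xi[OF br p]
      D_Phi[OF X Y p] D_Phi[OF Y X p] g_D_xi[OF X Y p] g_D_xi[OF Y X p] D_xi[OF X p] D_xi[OF Y p] t1 t2 t3 s
    by algebra
qed

lemma g_curvature_xi:
  assumes X: "X \<in> vector_fields M" and Y: "Y \<in> vector_fields M" and W: "W \<in> vector_fields M" and p: "p \<in> points M"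
  shows "g p (curvature D X Y \<xi> p) (W p) =
      (- X p \<alpha> - 2 * \<alpha> p * \<beta> p * g p (X p) (\<xi> p)) * g p (\<phi> p (Y p)) (W p)
    + (Y p \<alpha> + 2 * \<alpha> p * \<beta> p * g p (Y p) (\<xi> p)) * g p (\<phi> p (X p)) (W p)
    + (X p \<beta> - ((\<alpha> p)\<^sup>2 - (\<beta> p)\<^sup>2) * g p (X p) (\<xi> p)) * g p (Y p) (W p)
    + (- Y p \<beta> + ((\<alpha> p)\<^sup>2 - (\<beta> p)\<^sup>2) * g p (Y p) (\<xi> p)) * g p (X p) (W p)
    + (Y p \<beta> * g p (X p) (\<xi> p) - X p \<beta> * g p (Y p) (\<xi> p)) * g p (\<xi> p) (W p)"
proof -
  note t = vector_field_tangent[OF Phi_vector_field[OF X] p] vector_field_tangent[OF Phi_vector_field[OF Y] p]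
    vector_field_tangent[OF X p] vector_field_tangent[OF Y p] vector_field_tangent[OF xi_vector_field p]
    vector_field_tangent[OF W p]
  have lin: "g p (\<lambda>h. c1 * \<phi> p (Y p) h + c2 * \<phi> p (X p) h + c3 * Y p h + c4 * X p h + c5 * \<xi> p h) (W p) =
      c1 * g p (\<phi> p (Y p)) (W p) + c2 * g p (\<phi> p (X p)) (W p) + c3 * g p (Y p) (W p)
      + c4 * g p (X p) (W p) + c5 * g p (\<xi> p) (W p)" for c1 c2 c3 c4 c5
    by (simp add: g_add g_cmult tangent_space_add tangent_space_cmult p t)
  show ?thesis
    unfolding lin[symmetric] by (rule arg_cong[of _ _ "\<lambda>v. g p v (W p)"]) (rule ext, rule curvature_xi[OF X Y p])
qed

section \<open>The Ricci curvature in the direction of the structure vector field\<close>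

text \<open>
  The trace in \<open>Ric(\<xi>,Y)\<close> is over \<open>R(E\<^sub>i,\<xi>)Y\<close>; the symmetries of the curvature tensor turn it into
  the trace of \<open>R(E\<^sub>i,Y)\<xi>\<close>, which \<open>curvature_xi\<close> evaluates. The frame hypothesis is what makes the
  choice operator in the definition of the Ricci tensor return an orthonormal frame.
\<close>

lemma ricci_xi:
  assumes Y: "Y \<in> vector_fields M" and p: "p \<in> points M" and frame: "\<exists>E. orthonormal_at M g p E"
  shows "ricci M g D \<xi> Y p = - \<phi> p (Y p) \<alpha> - (real DIM('e) - 2) * Y p \<beta> - g p (Y p) (\<xi> p) * \<xi> p \<beta>
    + (real DIM('e) - 1) * ((\<alpha> p)\<^sup>2 - (\<beta> p)\<^sup>2) * g p (Y p) (\<xi> p)"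
proof -
  define E where "E = (SOME E. orthonormal_at M g p E)"
  have E: "orthonormal_at M g p E"
    unfolding E_def using frame by (rule someI_ex)
  let ?N = "DIM('e)" and ?c = "(\<alpha> p)\<^sup>2 - (\<beta> p)\<^sup>2" and ?e = "g p (Y p) (\<xi> p)"
  note Yp = vector_field_tangent[OF Y p] and \<xi>p = vector_field_tangent[OF xi_vector_field p]
    and PYp = vector_field_tangent[OF Phi_vector_field[OF Y] p]
  have summand: "g p (curvature D (E i) \<xi> Y p) (E i p) =
      - (g p (\<phi> p (Y p)) (E i p) * E i p \<alpha>) - 2 * \<alpha> p * \<beta> p * (g p (\<phi> p (Y p)) (E i p) * g p (E i p) (\<xi> p))
      + g p (Y p) (E i p) * E i p \<beta> - ?c * (g p (Y p) (E i p) * g p (E i p) (\<xi> p))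
      + (?c * ?e - Y p \<beta>)
      + Y p \<beta> * (g p (\<xi> p) (E i p) * g p (E i p) (\<xi> p)) - ?e * (g p (\<xi> p) (E i p) * E i p \<beta>)"
    if i: "i < ?N" for i
  proof -
    have Ei: "E i \<in> vector_fields M" and n: "g p (E i p) (E i p) = 1"
      using E i by (auto simp: orthonormal_at_def)
    have tr: "g p (\<phi> p (E i p)) (E i p) = 0"
      using g_phi_skew[OF Ei Ei p] g_field_sym[OF Ei Phi_vector_field[OF Ei] p] by simp
    have "g p (curvature D (E i) \<xi> Y p) (E i p) = g p (curvature D Y (E i) (E i) p) (\<xi> p)"
      by (rule g_curvature_pair_symmetry[OF Ei xi_vector_field Y Ei p])
    also have "\<dots> = - g p (curvature D Y (E i) \<xi> p) (E i p)"
      by (rule g_curvature_skew[OF Y Ei Ei xi_vector_field p])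
    finally show ?thesis
      unfolding g_curvature_xi[OF Y Ei Ei p] n tr by (simp add: algebra_simps)
  qed
  have sums: "(\<Sum>i<?N. g p w (E i p) * E i p h) = w h" if "w \<in> tangent_space M p" for w h
    using orthonormal_expansion[OF p E that] by simp
  note inner = orthonormal_parseval[OF p E _ \<xi>p]
  have "ricci M g D \<xi> Y p = (\<Sum>i<?N. g p (curvature D (E i) \<xi> Y p) (E i p))"
    by (simp add: ricci_def E_def Let_def)
  also have "\<dots> = - \<phi> p (Y p) \<alpha> - 2 * \<alpha> p * \<beta> p * g p (\<phi> p (Y p)) (\<xi> p) + Y p \<beta> - ?c * ?e
      + real ?N * (?c * ?e - Y p \<beta>) + Y p \<beta> * g p (\<xi> p) (\<xi> p) - ?e * \<xi> p \<beta>"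
    by (simp add: summand sum.distrib sum_subtractf sum_negf sums[OF PYp] sums[OF Yp] sums[OF \<xi>p]
        inner[OF PYp] inner[OF Yp] inner[OF \<xi>p] flip: sum_distrib_left)
  finally show ?thesis
    using g_phi_xi[OF Y p] g_xi_xi[OF p] by (simp add: algebra_simps)
qed

text \<open>
  In dimension at least two some tangent vector is not a multiple of \<open>\<xi>\<close>; extend it to a field,
  subtract the component along \<open>\<xi>\<close> everywhere, and rescale by a constant to have length one at \<open>p\<close>.
\<close>

lemma exists_unit_horizontal_field:
  assumes dim: "DIM('e) \<ge> 2" and p: "p \<in> points M"
  obtains X where "X \<in> vector_fields M" "\<And>q. q \<in> points M \<Longrightarrow> g q (X q) (\<xi> q) = 0" "g p (X p) (X p) = 1"
proof -
  from tangent_space_coordinates[OF p] obtain y :: "'e \<Rightarrow> 'a \<Rightarrow> real" where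
    y: "(\<forall>u\<in>tangent_space M p. \<forall>w\<in>tangent_space M p. (\<forall>b\<in>Basis. u (y b) = w (y b)) \<longrightarrow> u = w) \<and>
    (\<forall>x. \<exists>u\<in>tangent_space M p. \<forall>b\<in>Basis. u (y b) = x \<bullet> b)" ..
  note surj = spec[OF conjunct2[OF y]]
  have "\<exists>u\<in>tangent_space M p. \<forall>a. u \<noteq> (\<lambda>h. a * \<xi> p h)"
  proof (rule ccontr)
    assume "\<not> ?thesis"
    then have multiple: "\<exists>a. u = (\<lambda>h. a * \<xi> p h)" if "u \<in> tangent_space M p" for u
      using that by blast
    have "\<not> card (Basis :: 'e set) \<le> Suc 0" using dim by simp
    then obtain b c :: 'e where bc: "b \<in> Basis" "c \<in> Basis" "b \<noteq> c"
      using card_le_Suc0_iff_eq[OF finite_Basis] by blast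
    obtain u where u: "u \<in> tangent_space M p" "\<forall>d\<in>Basis. u (y d) = b \<bullet> d" using surj by blast
    obtain w where w: "w \<in> tangent_space M p" "\<forall>d\<in>Basis. w (y d) = c \<bullet> d" using surj by blast
    obtain r where r: "u = (\<lambda>h. r * \<xi> p h)" using multiple[OF u(1)] by blast
    obtain s where s: "w = (\<lambda>h. s * \<xi> p h)" using multiple[OF w(1)] by blast
    have "r * \<xi> p (y b) = 1" "s * \<xi> p (y b) = 0" "s * \<xi> p (y c) = 1"
      using u(2) w(2) bc by (auto simp: r s inner_Basis)
    then show False by auto
  qed
  then obtain u where u: "u \<in> tangent_space M p" "\<And>a. u \<noteq> (\<lambda>h. a * \<xi> p h)" by blast
  obtain Y where Y: "Y \<in> vector_fields M" "Y p = u" using tangent_vector_extends[OF p u(1)] by blast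
  define Z where "Z q h = Y q h - g q (Y q) (\<xi> q) * \<xi> q h" for q h
  have e\<xi>: "(\<lambda>q h. g q (Y q) (\<xi> q) * \<xi> q h) \<in> vector_fields M"
    by (rule vector_field_fmult[OF g_C_inf[OF Y(1) xi_vector_field] xi_vector_field])
  have Z: "Z \<in> vector_fields M"
    using vector_field_diff[OF Y(1) e\<xi>] by (simp add: Z_def[abs_def])
  have hor: "g q (Z q) (\<xi> q) = 0" if q: "q \<in> points M" for q
    using g_diff[OF q vector_field_tangent[OF Y(1) q] vector_field_tangent[OF e\<xi> q] vector_field_tangent[OF xi_vector_field q]]
      g_cmult[OF q vector_field_tangent[OF xi_vector_field q] vector_field_tangent[OF xi_vector_field q]] g_xi_xi[OF q]
    by (simp add: Z_def[abs_def])
  have "Z p \<noteq> (\<lambda>h. 0)"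
  proof
    assume zero: "Z p = (\<lambda>h. 0)"
    have "Y p h = g p (Y p) (\<xi> p) * \<xi> p h" for h
      using fun_cong[OF zero, of h] by (simp add: Z_def)
    then show False using u(2)[of "g p (Y p) (\<xi> p)"] Y(2) by (simp add: fun_eq_iff)
  qed
  then have pos: "g p (Z p) (Z p) > 0"
    by (rule g_pos[OF p vector_field_tangent[OF Z p]])
  \<comment> \<open>A constant factor keeps the field smooth; it has unit length at \<open>p\<close> only.\<close>
  define r where "r = 1 / sqrt (g p (Z p) (Z p))"
  define X where "X q h = r * Z q h" for q h
  have X: "X \<in> vector_fields M"
    using vector_field_fmult[OF C_inf_const Z, of r] by (simp add: X_def[abs_def])
  have gX: "g q (X q) w = r * g q (Z q) w" if "q \<in> points M" "w \<in> tangent_space M q" for q w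
    using g_cmult[OF that(1) vector_field_tangent[OF Z that(1)] that(2)] by (simp add: X_def[abs_def])
  have "g p (X p) (X p) = r * (r * g p (Z p) (Z p))"
    using gX[OF p vector_field_tangent[OF X p]] gX[OF p vector_field_tangent[OF Z p]] g_field_sym[OF Z X p] by simp
  also have "\<dots> = 1" using pos by (simp add: r_def field_simps)
  finally show thesis
    using that[OF X] gX hor vector_field_tangent[OF xi_vector_field] by simp
qed

text \<open>
  Pair symmetry makes \<open>g(R(X,\<xi>)\<xi>,Y)\<close> symmetric in \<open>X\<close> and \<open>Y\<close>, whereas its part involving \<open>\<phi>\<close> is
  \<open>(\<xi>\<alpha> + 2\<alpha>\<beta>) g(\<phi>X,Y)\<close>, which is skew.
\<close>

lemma derivative_alpha_along_xi:
  assumes dim: "DIM('e) \<ge> 2" and p: "p \<in> points M"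
  shows "\<xi> p \<alpha> = - 2 * \<alpha> p * \<beta> p"
proof -
  obtain X where X: "X \<in> vector_fields M" "\<And>q. q \<in> points M \<Longrightarrow> g q (X q) (\<xi> q) = 0" "g p (X p) (X p) = 1"
    using exists_unit_horizontal_field[OF dim p] by blast
  note PX = Phi_vector_field[OF X(1)]
  let ?r = "\<lambda>X Y. g p (curvature D X \<xi> \<xi> p) (Y p)"
  have "?r X (\<Phi> X) = g p (curvature D \<xi> (\<Phi> X) X p) (\<xi> p)"
    by (rule g_curvature_pair_symmetry[OF X(1) xi_vector_field xi_vector_field PX p])
  also have "\<dots> = - g p (curvature D \<xi> (\<Phi> X) \<xi> p) (X p)"
    by (rule g_curvature_skew[OF xi_vector_field PX X(1) xi_vector_field p])
  finally have eq: "?r X (\<Phi> X) = - g p (curvature D \<xi> (\<Phi> X) \<xi> p) (X p)" .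
  have v: "g p (\<phi> p (X p)) (X p) = 0" "g p (X p) (\<phi> p (X p)) = 0" "g p (\<phi> p (X p)) (\<phi> p (X p)) = 1"
    "g p (\<phi> p (\<phi> p (X p))) (X p) = -1" "g p (\<xi> p) (X p) = 0" "g p (\<phi> p (X p)) (\<xi> p) = 0"
    "g p (\<xi> p) (\<phi> p (X p)) = 0"
    using g_phi_skew[OF X(1) X(1) p] g_field_sym[OF X(1) PX p] g_phi_phi[OF X(1) X(1) p] X(2)[OF p] X(3)
      g_phi_skew[OF PX X(1) p] g_field_sym[OF xi_vector_field X(1) p] g_phi_xi[OF X(1) p] g_field_sym[OF xi_vector_field PX p]
    by simp_all
  have "g p (\<lambda>h. 0) (X p) = 0" "g p (\<lambda>h. 0) (\<phi> p (X p)) = 0"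
    using g_zero[OF p] vector_field_tangent[OF X(1) p] vector_field_tangent[OF PX p] by simp_all
  then show ?thesis
    using eq unfolding g_curvature_xi[OF X(1) xi_vector_field PX p] g_curvature_xi[OF xi_vector_field PX X(1) p]
    using X(2)[OF p] v g_xi_xi[OF p] by (simp add: phi_xi[OF p] X(3))
qed

text \<open>
  The frame consists of a unit field \<open>X\<close> orthogonal to \<open>\<xi>\<close>, of \<open>\<phi>X\<close>, and of \<open>\<xi>\<close>.
\<close>

lemma exists_orthonormal_frame:
  assumes dim: "DIM('e) = 3" and p: "p \<in> points M"
  shows "\<exists>E. orthonormal_at M g p E"
proof -
  obtain X where X: "X \<in> vector_fields M" "\<And>q. q \<in> points M \<Longrightarrow> g q (X q) (\<xi> q) = 0" "g p (X p) (X p) = 1"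
    using exists_unit_horizontal_field[OF _ p] dim by auto
  note PX = Phi_vector_field[OF X(1)]
  have v: "g p (\<phi> p (X p)) (X p) = 0" "g p (X p) (\<phi> p (X p)) = 0" "g p (\<phi> p (X p)) (\<phi> p (X p)) = 1"
    "g p (\<xi> p) (X p) = 0" "g p (\<phi> p (X p)) (\<xi> p) = 0" "g p (\<xi> p) (\<phi> p (X p)) = 0"
    using g_phi_skew[OF X(1) X(1) p] g_field_sym[OF X(1) PX p] g_phi_phi[OF X(1) X(1) p] X(2)[OF p] X(3)
      g_field_sym[OF xi_vector_field X(1) p] g_phi_xi[OF X(1) p] g_field_sym[OF xi_vector_field PX p]
    by simp_all
  define E where "E i = (if i = 0 then X else if i = 1 then \<Phi> X else \<xi>)" for i :: nat
  have "orthonormal_at M g p E"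
    unfolding orthonormal_at_def dim E_def
    using X(1,3) PX xi_vector_field v X(2)[OF p] g_xi_xi[OF p] by (auto simp: less_Suc_eq numeral_3_eq_3)
  then show ?thesis by blast
qed

section \<open>The maximum principle\<close>

text \<open>
  The equation \<open>CR\<close> combines \<open>\<xi>\<beta> = \<alpha>\<^sup>2 - \<beta>\<^sup>2\<close> with the Cauchy-Riemann equations along the
  hyperplanes orthogonal to \<open>\<xi>\<close>. These express \<open>XX\<alpha> + (\<phi>X)(\<phi>X)\<alpha>\<close> as \<open>[X,\<phi>X]\<beta>\<close>, and the bracket has
  the component \<open>2\<alpha>\<close> along \<open>\<xi>\<close> because \<open>\<nabla>\<xi>\<close> has the skew part \<open>-\<alpha>\<phi>\<close>. The sign of the resulting
  term contradicts the second derivative test.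
\<close>

lemma structure_functions_vanish_at_max:
  assumes dim: "DIM('e) \<ge> 2"
    and p: "p \<in> points M"
    and max: "\<And>q. q \<in> points M \<Longrightarrow> (\<alpha> q)\<^sup>2 + (\<beta> q)\<^sup>2 \<le> (\<alpha> p)\<^sup>2 + (\<beta> p)\<^sup>2"
    and CR: "\<And>Y q. Y \<in> vector_fields M \<Longrightarrow> q \<in> points M \<Longrightarrow>
      Y q \<beta> + \<phi> q (Y q) \<alpha> = ((\<alpha> q)\<^sup>2 - (\<beta> q)\<^sup>2) * g q (Y q) (\<xi> q)"
  shows "(\<alpha> p)\<^sup>2 + (\<beta> p)\<^sup>2 = 0"
proof (rule ccontr)
  assume nz: "\<not> ?thesis"
  let ?f = "\<lambda>q. (\<alpha> q)\<^sup>2 + (\<beta> q)\<^sup>2"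
  have f_eq: "?f = (\<lambda>q. \<alpha> q * \<alpha> q + \<beta> q * \<beta> q)" by (simp add: power2_eq_square)
  have f: "?f \<in> C_inf M"
    unfolding f_eq by (intro C_inf_add C_inf_mult alpha_smooth beta_smooth)
  note hess = hessian_nonpos_at_max[OF p _ f max]
  have df: "X q ?f = 2 * (\<alpha> q * X q \<alpha> + \<beta> q * X q \<beta>)" if "X \<in> vector_fields M" "q \<in> points M" for X q
    using tangent_mult[OF vector_field_tangent[OF that] alpha_smooth alpha_smooth] tangent_mult[OF vector_field_tangent[OF that] beta_smooth beta_smooth]
      tangent_add[OF vector_field_tangent[OF that] C_inf_mult[OF alpha_smooth alpha_smooth] C_inf_mult[OF beta_smooth beta_smooth]]
    by (simp add: f_eq)
  \<comment> \<open>Since \<open>0 = \<xi>f = -2\<beta>f\<close>, the function \<open>\<beta>\<close> vanishes at \<open>p\<close>, and then so do all derivatives of \<open>\<alpha>\<close>.\<close>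
  have "0 = 2 * (\<alpha> p * \<xi> p \<alpha> + \<beta> p * \<xi> p \<beta>)"
    using hess(1)[OF xi_vector_field] df[OF xi_vector_field p] by simp
  moreover have "\<xi> p \<beta> = (\<alpha> p)\<^sup>2 - (\<beta> p)\<^sup>2"
    using CR[OF xi_vector_field p] g_xi_xi[OF p] by (simp add: phi_xi[OF p])
  ultimately have "\<beta> p * ((\<alpha> p)\<^sup>2 + (\<beta> p)\<^sup>2) = 0"
    unfolding derivative_alpha_along_xi[OF dim p] by (simp add: power2_eq_square algebra_simps)
  then have b: "\<beta> p = 0" using nz by auto
  then have a: "\<alpha> p \<noteq> 0" using nz by simp
  have d\<alpha>: "X p \<alpha> = 0" if "X \<in> vector_fields M" for X
    using hess(1)[OF that] df[OF that p] a b by simp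
  have d\<beta>: "X p \<beta> = (\<alpha> p)\<^sup>2 * g p (X p) (\<xi> p)" if "X \<in> vector_fields M" for X
    using CR[OF that p] d\<alpha>[OF Phi_vector_field[OF that]] b by simp
  obtain X where X: "X \<in> vector_fields M" "\<And>q. q \<in> points M \<Longrightarrow> g q (X q) (\<xi> q) = 0" "g p (X p) (X p) = 1"
    using exists_unit_horizontal_field[OF dim p] by blast
  note PX = Phi_vector_field[OF X(1)]
  \<comment> \<open>At \<open>p\<close> only one of the terms of \<open>ZZf\<close> survives.\<close>
  have XX: "Z p (\<lambda>q. Z q ?f) = 2 * \<alpha> p * Z p (\<lambda>q. Z q \<alpha>)"
    if Z: "Z \<in> vector_fields M" "g p (Z p) (\<xi> p) = 0" for Z
  proof -
    note Zp = vector_field_tangent[OF Z(1) p]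
    note Z\<alpha> = vector_field_C_inf[OF Z(1) alpha_smooth] and Z\<beta> = vector_field_C_inf[OF Z(1) beta_smooth]
    have "Z p (\<lambda>q. Z q ?f) = Z p (\<lambda>q. 2 * (\<alpha> q * Z q \<alpha> + \<beta> q * Z q \<beta>))"
      by (rule tangent_cong[OF Zp p]) (rule df[OF Z(1)])
    also have "\<dots> = 2 * (Z p (\<lambda>q. \<alpha> q * Z q \<alpha>) + Z p (\<lambda>q. \<beta> q * Z q \<beta>))"
      by (simp only: tangent_cmult[OF Zp C_inf_add[OF C_inf_mult[OF alpha_smooth Z\<alpha>] C_inf_mult[OF beta_smooth Z\<beta>]]]
        tangent_add[OF Zp C_inf_mult[OF alpha_smooth Z\<alpha>] C_inf_mult[OF beta_smooth Z\<beta>]])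
    also have "\<dots> = 2 * \<alpha> p * Z p (\<lambda>q. Z q \<alpha>)"
      by (simp add: tangent_mult[OF Zp alpha_smooth Z\<alpha>] tangent_mult[OF Zp beta_smooth Z\<beta>] d\<alpha>[OF Z(1)] d\<beta>[OF Z(1)] Z(2) b)
    finally show ?thesis .
  qed
  \<comment> \<open>These two equations hold at all points, so that they can be differentiated once more.\<close>
  have h1: "X q \<alpha> = \<phi> q (X q) \<beta>" if "q \<in> points M" for q
    using CR[OF PX that] phi_phi[OF X(1) that, of "\<alpha>"] X(2)[OF that] g_phi_xi[OF X(1) that] by simp
  have h2: "\<phi> q (X q) \<alpha> = - X q \<beta>" if "q \<in> points M" for q
    using CR[OF X(1) that] X(2)[OF that] by simp
  have "X p (\<lambda>q. X q \<alpha>) = X p (\<lambda>q. \<phi> q (X q) \<beta>)"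
    by (rule tangent_cong[OF vector_field_tangent[OF X(1) p] p h1])
  moreover have "\<phi> p (X p) (\<lambda>q. \<phi> q (X q) \<alpha>) = - \<phi> p (X p) (\<lambda>q. X q \<beta>)"
    using tangent_cong[OF vector_field_tangent[OF PX p] p h2]
      tangent_minus[OF vector_field_tangent[OF PX p] vector_field_C_inf[OF X(1) beta_smooth]] by simp
  ultimately have "X p (\<lambda>q. X q \<alpha>) + \<phi> p (X p) (\<lambda>q. \<phi> q (X q) \<alpha>) = lie_bracket X (\<Phi> X) p \<beta>"
    by (simp add: lie_bracket_def)
  also have "\<dots> = (\<alpha> p)\<^sup>2 * g p (lie_bracket X (\<Phi> X) p) (\<xi> p)"
    by (rule d\<beta>[OF vector_field_bracket[OF X(1) PX]])
  also have "g p (lie_bracket X (\<Phi> X) p) (\<xi> p) = 2 * \<alpha> p"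
  proof -
    note DXP = D_vector_field[OF X(1) PX] and DPX = D_vector_field[OF PX X(1)]
    have "lie_bracket X (\<Phi> X) p = (\<lambda>h. D X (\<Phi> X) p h - D (\<Phi> X) X p h)"
      using torsion_free[OF X(1) PX p] by auto
    then have br: "g p (lie_bracket X (\<Phi> X) p) (\<xi> p) = g p (D X (\<Phi> X) p) (\<xi> p) - g p (D (\<Phi> X) X p) (\<xi> p)"
      using g_diff[OF p vector_field_tangent[OF DXP p] vector_field_tangent[OF DPX p] vector_field_tangent[OF xi_vector_field p]]
      by simp
    have hor: "g p (D Z W p) (\<xi> p) = \<alpha> p * g p (\<phi> p (Z p)) (W p)"
      if Z: "Z \<in> vector_fields M" and W: "W \<in> vector_fields M" and
        WZ: "\<And>q. q \<in> points M \<Longrightarrow> g q (W q) (\<xi> q) = 0" for Z W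
    proof -
      have "Z p (\<lambda>q. g q (W q) (\<xi> q)) = 0"
        using tangent_cong[OF vector_field_tangent[OF Z p] p WZ] tangent_const[OF vector_field_tangent[OF Z p]] by simp
      then show ?thesis
        using metric_compatible[OF Z W xi_vector_field p] g_D_xi[OF Z W p] g_field_sym[OF W D_vector_field[OF Z xi_vector_field] p] b by simp
    qed
    show ?thesis
      using br hor[OF X(1) PX g_phi_xi[OF X(1)]] hor[OF PX X(1,2)] g_phi_phi[OF X(1) X(1) p] g_phi_skew[OF PX X(1) p] X(2)[OF p] X(3) by simp
  qed
  finally have "X p (\<lambda>q. X q ?f) + \<phi> p (X p) (\<lambda>q. \<phi> q (X q) ?f) = 4 * (\<alpha> p)\<^sup>2 * (\<alpha> p)\<^sup>2"
    using XX[OF X(1) X(2)[OF p]] XX[OF PX g_phi_xi[OF X(1) p]]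
    by (simp add: power2_eq_square algebra_simps flip: distrib_left)
  moreover have "X p (\<lambda>q. X q ?f) + \<phi> p (X p) (\<lambda>q. \<phi> q (X q) ?f) \<le> 0"
    using hess(2)[OF X(1)] hess(2)[OF PX] by simp
  moreover have "4 * (\<alpha> p)\<^sup>2 * (\<alpha> p)\<^sup>2 > 0" using a by simp
  ultimately show False by linarith
qed

end

section \<open>Cosymplectic manifolds and the Ricci operator\<close>

theorem theorem4p1:
  fixes M :: "('a, real^3) manifold"
    and \<phi> Q :: "'a \<Rightarrow> 'a tvec \<Rightarrow> 'a tvec"
    and \<xi> :: "'a vfield"
    and \<eta> :: "'a \<Rightarrow> 'a tvec \<Rightarrow> real"
    and g :: "'a \<Rightarrow> 'a tvec \<Rightarrow> 'a tvec \<Rightarrow> real"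
    and D :: "'a vfield \<Rightarrow> 'a vfield \<Rightarrow> 'a vfield"
    and \<alpha> \<beta> :: "'a \<Rightarrow> real"
  assumes "trans_sasakian M \<phi> \<xi> \<eta> g D \<alpha> \<beta>"
    and "compact_space (man_top M)"
    and "connected_space (man_top M)"
    and "ricci_operator M g D Q"
  shows "cosymplectic M \<phi> \<xi> \<eta> g D \<alpha> \<beta> \<longleftrightarrow> (\<forall>p\<in>points M. Q p (\<xi> p) = (\<lambda>h. 0))"
proof -
  interpret trans_sasakian_mfd M g D \<phi> \<xi> \<eta> \<alpha> \<beta>
    using assms(1)
    by unfold_locales (auto simp: trans_sasakian_def almost_contact_metric_def)
  have dim: "DIM(real^3) = 3" by simp
  have Q: "(\<lambda>p. Q p (X p)) \<in> vector_fields M" if "X \<in> vector_fields M" for X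
    using assms(4) that unfolding ricci_operator_def tensor_field_11_def by blast
  have ric: "g p (Q p (\<xi> p)) (Y p) = - \<phi> p (Y p) \<alpha> - Y p \<beta> - g p (Y p) (\<xi> p) * \<xi> p \<beta>
      + 2 * ((\<alpha> p)\<^sup>2 - (\<beta> p)\<^sup>2) * g p (Y p) (\<xi> p)"
    if Y: "Y \<in> vector_fields M" and p: "p \<in> points M" for Y p
  proof -
    have "g p (Q p (\<xi> p)) (Y p) = ricci M g D \<xi> Y p"
      using assms(4) Y p xi_vector_field unfolding ricci_operator_def by simp
    then show ?thesis
      using ricci_xi[OF Y p exists_orthonormal_frame[OF dim p]] by (simp add: dim)
  qed
  show ?thesis
  proof
    assume "cosymplectic M \<phi> \<xi> \<eta> g D \<alpha> \<beta>"
    then have zero: "\<alpha> p = 0" "\<beta> p = 0" if "p \<in> points M" for p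
      using that by (auto simp: cosymplectic_def)
    show "\<forall>p\<in>points M. Q p (\<xi> p) = (\<lambda>h. 0)"
    proof
      fix p assume p: "p \<in> points M"
      have d: "Y p \<alpha> = 0" "Y p \<beta> = 0" if "Y \<in> vector_fields M" for Y
        using tangent_cong[OF vector_field_tangent[OF that p] p zero(1)]
          tangent_cong[OF vector_field_tangent[OF that p] p zero(2)]
          tangent_const[OF vector_field_tangent[OF that p]] by simp_all
      note Q\<xi> = Q[OF xi_vector_field]
      \<comment> \<open>Test the Ricci tensor against the field \<open>Q\<xi>\<close> itself.\<close>
      have "g p (Q p (\<xi> p)) (Q p (\<xi> p)) = 0"
        using ric[OF Q\<xi> p] zero[OF p] d[OF Q\<xi>] d[OF Phi_vector_field[OF Q\<xi>]] d[OF xi_vector_field] by simp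
      then show "Q p (\<xi> p) = (\<lambda>h. 0)"
        using g_pos[OF p vector_field_tangent[OF Q\<xi> p]] by fastforce
    qed
  next
    assume Q0: "\<forall>p\<in>points M. Q p (\<xi> p) = (\<lambda>h. 0)"
    have ric0: "- \<phi> p (Y p) \<alpha> - Y p \<beta> - g p (Y p) (\<xi> p) * \<xi> p \<beta>
      + 2 * ((\<alpha> p)\<^sup>2 - (\<beta> p)\<^sup>2) * g p (Y p) (\<xi> p) = 0"
      if "Y \<in> vector_fields M" "p \<in> points M" for Y p
      using ric[OF that] Q0 that g_zero[OF that(2) vector_field_tangent[OF that]] by simp
    have \<xi>\<beta>: "\<xi> p \<beta> = (\<alpha> p)\<^sup>2 - (\<beta> p)\<^sup>2" if "p \<in> points M" for p
      using ric0[OF xi_vector_field that] g_xi_xi[OF that] by (simp add: phi_xi[OF that])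
    have CR: "Y p \<beta> + \<phi> p (Y p) \<alpha> = ((\<alpha> p)\<^sup>2 - (\<beta> p)\<^sup>2) * g p (Y p) (\<xi> p)"
      if "Y \<in> vector_fields M" "p \<in> points M" for Y p
      using ric0[OF that] unfolding \<xi>\<beta>[OF that(2)] by (simp add: algebra_simps)
    have "\<alpha> q = 0 \<and> \<beta> q = 0" if q: "q \<in> points M" for q
    proof -
      have f: "(\<lambda>q. (\<alpha> q)\<^sup>2 + (\<beta> q)\<^sup>2) \<in> C_inf M"
        unfolding power2_eq_square by (intro C_inf_add C_inf_mult alpha_smooth beta_smooth)
      obtain p where p: "p \<in> points M" "\<And>q. q \<in> points M \<Longrightarrow> (\<alpha> q)\<^sup>2 + (\<beta> q)\<^sup>2 \<le> (\<alpha> p)\<^sup>2 + (\<beta> p)\<^sup>2"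
        using C_inf_attains_max[OF assms(2) _ f] q by blast
      have "(\<alpha> p)\<^sup>2 + (\<beta> p)\<^sup>2 = 0"
      proof (rule structure_functions_vanish_at_max)
        show "Y q \<beta> + \<phi> q (Y q) \<alpha> = ((\<alpha> q)\<^sup>2 - (\<beta> q)\<^sup>2) * g q (Y q) (\<xi> q)"
          if "Y \<in> vector_fields M" "q \<in> points M" for Y q
          using CR[OF that] .
      qed (simp_all add: dim p)
      then have "(\<alpha> q)\<^sup>2 + (\<beta> q)\<^sup>2 \<le> 0" using p(2)[OF q] by simp
      then show ?thesis by (simp add: sum_power2_le_zero_iff)
    qed
    then show "cosymplectic M \<phi> \<xi> \<eta> g D \<alpha> \<beta>"
      using assms(1) by (simp add: cosymplectic_def)
  qed
qed

end
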